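(* For any $\epsilon>0$, achieving a $(\frac{5}{2}-\epsilon)$-approximation of $\alpha(G)$, with constant probability of success, on an $l_1$ or $l_\infty$ ball stream with $d=2$ and dilation $\Delta=1$ requires $\Omega(n)$ space.
   Context: A $d$-dimensional $l^p$ ball stream is a sequence of $n$ pairs $(x_i,r_i)\in[M]^d\times[M]$ (with $M$ polynomial in $n$), each describing the closed ball $\{y\in\mathbb{R}^d:\|y-x_i\|_p\le r_i\}$; it defines the intersection graph $G$ with one vertex per ball and an edge between two balls iff $\|x_i-x_j\|_p\le r_i+r_j$. The stream is read once. The dilation $\Delta$ is the ratio between the largest and smallest radii in the stream. $\alpha(G)$ is the maximum size of an independent set; a $c$-approximation to $\alpha(G)$ is a value $\gamma$ with $\frac{1}{c}\alpha(G)\le\gamma\le\alpha(G)$. *)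

theory Defs
  imports "HOL-Analysis.Analysis" "HOL-Probability.Probability" "HOL-Library.Landau_Symbols"
begin

definition lp_norm :: "ereal \<Rightarrow> real ^ ('d::finite) \<Rightarrow> real" where
  "lp_norm p x =
     (if p = \<infinity> then infnorm x
      else (\<Sum>i\<in>UNIV. \<bar>x $ i\<bar> powr real_of_ereal p) powr (1 / real_of_ereal p))"

type_synonym 'd lball = "(nat ^ 'd) \<times> nat"

definition real_centre :: "('d::finite) lball \<Rightarrow> real ^ 'd" where
  "real_centre b = (\<chi> i. real (fst b $ i))"

text \<open>Here \<open>[M]\<close> is \<open>{1..M}\<close>.\<close>
definition ball_stream :: "nat \<Rightarrow> nat \<Rightarrow> ('d::finite) lball list \<Rightarrow> bool" where
  "ball_stream n M bs \<longleftrightarrow>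
     length bs = n \<and> (\<forall>(x, r)\<in>set bs. (\<forall>i. x $ i \<in> {1..M}) \<and> r \<in> {1..M})"

definition dilation :: "('d::finite) lball list \<Rightarrow> real" where
  "dilation bs = real (Max (snd ` set bs)) / real (Min (snd ` set bs))"

type_synonym 'v graph = "'v set \<times> 'v set set"

definition independent_set :: "'v graph \<Rightarrow> 'v set \<Rightarrow> bool" where
  "independent_set G S \<longleftrightarrow> S \<subseteq> fst G \<and> (\<forall>u\<in>S. \<forall>v\<in>S. {u, v} \<notin> snd G)"

definition independence_number :: "'v graph \<Rightarrow> nat" where
  "independence_number G = Max (card ` {S. independent_set G S})"

text \<open>Vertices are positions in the stream, so a ball occurring twice gives two adjacent vertices.\<close>
definition intersection_graph :: "ereal \<Rightarrow> ('d::finite) lball list \<Rightarrow> nat graph" where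
  "intersection_graph p bs =
     ({..<length bs},
      {{i, j} | i j. i < length bs \<and> j < length bs \<and> i \<noteq> j \<and>
         lp_norm p (real_centre (bs ! i) - real_centre (bs ! j))
           \<le> real (snd (bs ! i)) + real (snd (bs ! j))})"

text \<open>
  Without \<open>0 < c\<close>, a nonpositive factor \<open>c\<close> would make \<open>\<gamma> = 0\<close> an approximation
  of every \<open>a\<close> (note that \<open>1 / 0 = 0\<close>).
\<close>
definition is_approximation :: "real \<Rightarrow> nat \<Rightarrow> real \<Rightarrow> bool" where
  "is_approximation c a \<gamma> \<longleftrightarrow> 0 < c \<and> 1 / c * real a \<le> \<gamma> \<and> \<gamma> \<le> real a"

text \<open>
  A deterministic one-pass algorithm, whose memory content is a bit string. The update may depend
  on the position in the stream, so neither a position counter nor the code of the algorithm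
  is charged as space. A randomized algorithm is a probability distribution over deterministic ones,
  so random bits are not charged either; because updates depend on the position, this
  subsumes algorithms that flip fresh coins in every step.
\<close>
record ('d::finite) stream_alg =
  init :: "bool list"
  update :: "nat \<Rightarrow> 'd lball \<Rightarrow> bool list \<Rightarrow> bool list"
  answer :: "bool list \<Rightarrow> real"

primrec memory :: "('d::finite) stream_alg \<Rightarrow> 'd lball list \<Rightarrow> nat \<Rightarrow> bool list" where
  "memory A bs 0 = init A"
| "memory A bs (Suc t) = update A t (bs ! t) (memory A bs t)"

definition result :: "('d::finite) stream_alg \<Rightarrow> 'd lball list \<Rightarrow> real" where
  "result A bs = answer A (memory A bs (length bs))"

definition uses_space :: "('d::finite) stream_alg pmf \<Rightarrow> 'd lball list \<Rightarrow> nat \<Rightarrow> bool" where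
  "uses_space R bs s \<longleftrightarrow> (\<forall>A\<in>set_pmf R. \<forall>t\<le>length bs. length (memory A bs t) \<le> s)"

definition approximates_alpha ::
  "('d::finite) stream_alg pmf \<Rightarrow> ereal \<Rightarrow> real \<Rightarrow> real \<Rightarrow> 'd lball list \<Rightarrow> bool" where
  "approximates_alpha R p c \<rho> bs \<longleftrightarrow>
     measure_pmf.prob R
       {A. is_approximation c (independence_number (intersection_graph p bs)) (result A bs)} \<ge> \<rho>"

end

theory Submission
  imports Defs
begin

text \<open>
  Both norms are handled as axis-parallel unit squares. Consider a ladder with \<open>L\<close> rungs whose joints are
  the corners of a slightly perturbed diagonal band of the unit grid: every rung and every piece of
  rail is a grid square with two opposite corners at joints, and each joint touches one more square,
  a cap, so that there are \<open>5 L\<close> squares and about \<open>2 L\<close> joints. Every rung or rail square is replaced by a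
  cluster of squares that move along its diagonal in tiny steps, the positions of later clusters
  depending on a hidden member of each earlier one, with much smaller steps. If all hidden members
  are present, then they and the caps are pairwise disjoint. If they are all absent, every remaining
  square has moved onto one of the joints, so that about \<open>2 L\<close> points pierce all squares. Telling the two
  situations apart is a chained index problem: flipping the presence of the hidden members one
  cluster at a time, some step solves the index problem with constant advantage, which needs a
  linear number of bits.
\<close>

section \<open>The chained index problem\<close>

text \<open>A crude form of cosh a <= exp (a^2 / 2): the linear terms of quadratic upper bounds for
  \<open>exp a\<close> and \<open>exp (- a)\<close> cancel.\<close>

lemma exp_add_exp_minus_le:
  fixes a :: real
  assumes "0 \<le> a" "a \<le> 1"
  shows "exp a + exp (- a) \<le> 2 * exp (a\<^sup>2)"
proof -
  \<comment> \<open>The product equals 1 + a^3.\<close>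
  have "1 \<le> (1 - a + a\<^sup>2) * (1 + a)"
    using assms by (simp add: algebra_simps power2_eq_square)
  also have "\<dots> \<le> (1 - a + a\<^sup>2) * exp a"
    using assms by (intro mult_left_mono exp_ge_add_one_self) auto
  finally have "exp (- a) \<le> 1 - a + a\<^sup>2"
    by (simp add: exp_minus field_simps)
  moreover have "exp a \<le> 1 + a + a\<^sup>2"
    using assms by (rule exp_bound)
  moreover have "1 + a\<^sup>2 \<le> exp (a\<^sup>2)"
    by (rule exp_ge_add_one_self)
  ultimately show ?thesis by linarith
qed

text \<open>A subset \<open>X\<close> encodes a vector of signs. Expanding the product sorts its
  terms by the set of factors that contribute \<open>exp (a i)\<close>; this is the factorisation of
  the moment generating function of a random signed sum.\<close>

lemma sum_Pow_exp_signed: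
  fixes a :: "'a \<Rightarrow> real"
  assumes "finite I"
  shows "(\<Sum>X\<in>Pow I. exp (\<Sum>i\<in>I. if i \<in> X then a i else - a i)) = (\<Prod>i\<in>I. exp (a i) + exp (- a i))"
proof -
  have "exp (\<Sum>i\<in>I. if i \<in> X then a i else - a i) = (\<Prod>i\<in>X. exp (a i)) * (\<Prod>i\<in>I - X. exp (- a i))"
    if "X \<in> Pow I" for X
  proof -
    have "(\<Sum>i\<in>I. if i \<in> X then a i else - a i) = (\<Sum>i\<in>X. a i) + (\<Sum>i\<in>I - X. - a i)"
      using that assms by (subst sum.subset_diff[of X I]) (auto intro: sum.cong)
    moreover have "finite X" using that assms finite_subset by auto
    ultimately show ?thesis using assms by (simp only: exp_add exp_sum finite_Diff)
  qed
  then show ?thesis by (simp add: prod_add[OF assms])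
qed

text \<open>Massart's finite class lemma: a message with \<open>card Q\<close> possible values correlates with at most
  \<open>O (sqrt (card I * ln (card Q)))\<close> of the bits of a uniformly random subset.\<close>
lemma index_advantage_le:
  fixes m :: "'a set \<Rightarrow> 'q" and g :: "'q \<Rightarrow> 'a \<Rightarrow> real" and lam :: real
  assumes "finite I" "finite Q" "\<And>X. X \<subseteq> I \<Longrightarrow> m X \<in> Q"
    and g: "\<And>q i. 0 \<le> g q i" "\<And>q i. g q i \<le> 1"
    and l: "0 \<le> lam" "lam \<le> 1"
  shows "lam * (\<Sum>X\<in>Pow I. \<Sum>i\<in>I. if i \<in> X then g (m X) i else - g (m X) i)
           \<le> 2 ^ card I * (ln (card Q) + lam\<^sup>2 * card I)"
proof -
  define Z where "Z q X = (\<Sum>i\<in>I. if i \<in> X then lam * g q i else - (lam * g q i))" for q X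
  define N where "N = (2 :: real) ^ card I"
  define z where "z = (\<Sum>X\<in>Pow I. Z (m X) X) / N"
  have N: "N > 0" "real (card (Pow I)) = N"
    using assms(1) by (auto simp: N_def card_Pow)
  have Qpos: "card Q > 0"
    using assms(2) assms(3)[of "{}"] by (auto simp: card_gt_0_iff)
  \<comment> \<open>Jensen's inequality for \<open>exp\<close>, by the tangent at the mean
    \<open>z\<close>: the deviations \<open>Z (m X) X - z\<close> sum to zero.\<close>
  have "N * exp z = (\<Sum>X\<in>Pow I. exp z * (1 + (Z (m X) X - z)))"
    using N by (simp add: sum_distrib_left[symmetric] sum.distrib sum_subtractf z_def)
  also have "\<dots> \<le> (\<Sum>X\<in>Pow I. exp z * exp (Z (m X) X - z))"
    by (intro sum_mono mult_left_mono exp_ge_add_one_self) auto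
  also have "\<dots> = (\<Sum>X\<in>Pow I. exp (Z (m X) X))"
    by (simp add: exp_diff)
  \<comment> \<open>The message depends on \<open>X\<close>. Summing over all of \<open>Q\<close>
    decouples the two, at the price of the term \<open>ln (card Q)\<close>.\<close>
  also have "\<dots> \<le> (\<Sum>X\<in>Pow I. \<Sum>q\<in>Q. exp (Z q X))"
    using assms by (intro sum_mono member_le_sum[where f = "\<lambda>q. exp (Z q _)"]) auto
  also have "\<dots> = (\<Sum>q\<in>Q. \<Sum>X\<in>Pow I. exp (Z q X))"
    by (rule sum.swap)
  also have "\<dots> \<le> (\<Sum>q\<in>Q. N * exp (lam\<^sup>2 * card I))"
  proof (intro sum_mono)
    fix q assume "q \<in> Q"
    have "(\<Sum>X\<in>Pow I. exp (Z q X)) = (\<Prod>i\<in>I. exp (lam * g q i) + exp (- (lam * g q i)))"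
      unfolding Z_def by (rule sum_Pow_exp_signed[OF assms(1)])
    also have "\<dots> \<le> (\<Prod>i\<in>I. 2 * exp (lam\<^sup>2))"
    proof (intro prod_mono conjI)
      fix i
      have le: "0 \<le> lam * g q i" "lam * g q i \<le> lam"
        using g l by (auto intro: mult_left_le)
      then have "exp (lam * g q i) + exp (- (lam * g q i)) \<le> 2 * exp ((lam * g q i)\<^sup>2)"
        using l by (intro exp_add_exp_minus_le) auto
      also have "\<dots> \<le> 2 * exp (lam\<^sup>2)"
        using le by (simp add: power_mono)
      finally show "exp (lam * g q i) + exp (- (lam * g q i)) \<le> 2 * exp (lam\<^sup>2)" .
    qed (simp add: add_nonneg_nonneg)
    also have "\<dots> = N * exp (lam\<^sup>2 * card I)"
      by (simp add: N_def power_mult_distrib exp_of_nat_mult[symmetric] mult.commute)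
    finally show "(\<Sum>X\<in>Pow I. exp (Z q X)) \<le> N * exp (lam\<^sup>2 * card I)" .
  qed
  finally have "exp z \<le> card Q * exp (lam\<^sup>2 * card I)"
    using N by simp
  also have "\<dots> = exp (ln (card Q) + lam\<^sup>2 * card I)"
    using Qpos by (simp add: exp_add)
  finally have "z \<le> ln (card Q) + lam\<^sup>2 * card I"
    by simp
  moreover have "lam * (\<Sum>X\<in>Pow I. \<Sum>i\<in>I. if i \<in> X then g (m X) i else - g (m X) i) = N * z"
  proof -
    have "N * z = (\<Sum>X\<in>Pow I. Z (m X) X)"
      using N by (simp add: z_def)
    also have "\<dots> = lam * (\<Sum>X\<in>Pow I. \<Sum>i\<in>I. if i \<in> X then g (m X) i else - g (m X) i)"
      unfolding Z_def sum_distrib_left by (intro sum.cong) auto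
    finally show ?thesis by simp
  qed
  ultimately show ?thesis
    using N by (simp add: N_def)
qed

text \<open>For \<open>i\<close> not in \<open>Y\<close>, both \<open>Y\<close> and
  \<open>insert i Y\<close> contribute the same difference on the left, whence the factor 2. This
  turns the effect of forcing a bit into a correlation with a uniformly random bit.\<close>

lemma sum_Pow_insert_minus_remove:
  fixes u :: "'a set \<Rightarrow> real"
  assumes "finite I" "i \<in> I"
  shows "(\<Sum>X\<in>Pow I. u (insert i X) - u (X - {i})) = 2 * (\<Sum>X\<in>Pow I. if i \<in> X then u X else - u X)"
proof -
  define J where "J = I - {i}"
  have I: "I = insert i J" and J: "i \<notin> J" "finite J"
    using assms by (auto simp: J_def)
  have inj: "inj_on (insert i) (Pow J)"
    using J by (auto simp: inj_on_def)
  have split: "sum f (Pow I) = (\<Sum>X\<in>Pow J. f X + f (insert i X))" for f :: "'a set \<Rightarrow> real"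
    unfolding I Pow_insert using J inj
    by (subst sum.union_disjoint) (auto simp: sum.reindex sum.distrib)
  have "(\<Sum>X\<in>Pow I. u (insert i X) - u (X - {i})) = (\<Sum>X\<in>Pow J. 2 * (u (insert i X) - u X))"
  proof -
    have "X - {i} = X" if "X \<in> Pow J" for X
      using that J by auto
    then show ?thesis
      unfolding split by (intro sum.cong) auto
  qed
  also have "\<dots> = 2 * (\<Sum>X\<in>Pow I. if i \<in> X then u X else - u X)"
    unfolding split sum_distrib_left using J by (intro sum.cong) auto
  finally show ?thesis .
qed

section \<open>Hybrid argument along the chain of players\<close>

definition chain_inputs :: "nat \<Rightarrow> nat \<Rightarrow> (nat \<Rightarrow> nat set \<times> nat) set" where
  "chain_inputs J B = ({..<J} \<rightarrow>\<^sub>E Pow {..<B} \<times> {..<B})"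

text \<open>In a chained index input \<open>w\<close>, player \<open>j\<close> holds the set \<open>fst (w j)\<close> and the hidden index \<open>snd (w j)\<close> is
  revealed to the later players; the first \<open>k\<close> sets are made to contain their index, the others to miss it.\<close>
definition force :: "nat \<Rightarrow> (nat \<Rightarrow> nat set \<times> nat) \<Rightarrow> nat \<Rightarrow> nat set \<times> nat" where
  "force k w j = (if j < k then insert (snd (w j)) (fst (w j)) else fst (w j) - {snd (w j)}, snd (w j))"

lemma finite_chain_inputs [simp]: "finite (chain_inputs J B)"
  by (auto simp: chain_inputs_def intro!: finite_PiE)

lemma chain_inputs_upd:
  "w \<in> chain_inputs J B \<Longrightarrow> k < J \<Longrightarrow> y \<in> Pow {..<B} \<times> {..<B} \<Longrightarrow> w(k := y) \<in> chain_inputs J B"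
  by (auto simp: chain_inputs_def PiE_def extensional_def Pi_iff)

text \<open>A uniformly random input stays uniform when one player's entry is redrawn: exchanging
  the old entry with the new one is an involution on the pairs \<open>(w, y)\<close>.\<close>

lemma sum_chain_inputs_resample:
  fixes f :: "(nat \<Rightarrow> nat set \<times> nat) \<Rightarrow> real"
  assumes "k < J"
  shows "(\<Sum>w\<in>chain_inputs J B. \<Sum>y\<in>Pow {..<B} \<times> {..<B}. f (w(k := y)))
           = real (2 ^ B * B) * sum f (chain_inputs J B)"
proof -
  let ?Y = "Pow {..<B} \<times> {..<B}"
  have "(\<Sum>w\<in>chain_inputs J B. \<Sum>y\<in>?Y. f (w(k := y)))
          = (\<Sum>(w, y)\<in>chain_inputs J B \<times> ?Y. f (w(k := y)))"
    by (rule sum.cartesian_product)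
  also have "\<dots> = (\<Sum>(w, y)\<in>chain_inputs J B \<times> ?Y. f w)"
    using assms
    by (intro sum.reindex_bij_witness[where i = "\<lambda>(w, y). (w(k := y), w k)" and j = "\<lambda>(w, y). (w(k := y), w k)"])
       (auto intro: chain_inputs_upd, auto simp: chain_inputs_def PiE_iff)
  also have "\<dots> = (\<Sum>w\<in>chain_inputs J B. \<Sum>y\<in>?Y. f w)"
    by (rule sum.cartesian_product[symmetric])
  also have "\<dots> = real (2 ^ B * B) * sum f (chain_inputs J B)"
    by (simp add: card_cartesian_product card_Pow sum_distrib_left)
  finally show ?thesis .
qed

text \<open>A hybrid argument: the players' hidden bits are flipped one at a time, and each flip is an
  instance of the two-party index problem.\<close>
lemma chain_advantage_le:
  fixes out :: "(nat \<Rightarrow> nat set \<times> nat) \<Rightarrow> real" and lam :: real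
  assumes Q: "finite Q" and "0 < B" and l: "0 \<le> lam" "lam \<le> 1"
    and out: "\<And>w. 0 \<le> out w" "\<And>w. out w \<le> 1"
    and msg: "\<And>w k. k < J \<Longrightarrow> (\<forall>j<J. w j \<in> Pow {..<B} \<times> {..<B}) \<Longrightarrow>
       \<exists>m g. \<forall>X\<subseteq>{..<B}. m X \<in> Q \<and> (\<forall>i<B. out (w(k := (X, i))) = g (m X) i)"
  shows "lam * B * (\<Sum>w\<in>chain_inputs J B. out (force J w) - out (force 0 w))
           \<le> 2 * real J * real (card (chain_inputs J B)) * (ln (card Q) + lam\<^sup>2 * B)"
proof -
  let ?Y = "Pow {..<B} \<times> {..<B}" and ?W = "chain_inputs J B"
  define E where "E = ln (card Q) + lam\<^sup>2 * B"
  have step: "lam * B * (\<Sum>w\<in>?W. out (force (Suc k) w) - out (force k w)) \<le> 2 * card ?W * E"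
    if k: "k < J" for k
  proof -
    have *: "lam * (\<Sum>y\<in>?Y. out (force (Suc k) (w(k := y))) - out (force k (w(k := y)))) \<le> 2 * (2 ^ B * E)"
      if w: "w \<in> ?W" for w
    proof -
      have "\<forall>j<J. force k w j \<in> ?Y"
        using w by (auto simp: force_def chain_inputs_def PiE_iff Pi_iff mem_Times_iff subset_iff)
      from msg[OF k this] obtain m g where
        mQ: "\<And>X. X \<subseteq> {..<B} \<Longrightarrow> m X \<in> Q" and
        g: "\<And>X i. X \<subseteq> {..<B} \<Longrightarrow> i < B \<Longrightarrow> out ((force k w)(k := (X, i))) = g (m X) i"
        by blast
      \<comment> \<open>Clamping to the unit interval gives the bounds for all arguments that
        \<open>index_advantage_le\<close> asks for, and changes nothing where \<open>g\<close> is a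
        value of \<open>out\<close>.\<close>
      define g' where "g' q i = max 0 (min 1 (g q i))" for q i
      have g': "out ((force k w)(k := (X, i))) = g' (m X) i" if "X \<subseteq> {..<B}" "i < B" for X i
        using g[OF that] out[of "(force k w)(k := (X, i))"] by (simp add: g'_def)
      \<comment> \<open>After redrawing, the two neighbouring hybrids agree except on whether the
        set of player \<open>k\<close> contains \<open>i\<close>.\<close>
      have f1: "force (Suc k) (w(k := (X, i))) = (force k w)(k := (insert i X, i))"
        and f2: "force k (w(k := (X, i))) = (force k w)(k := (X - {i}, i))" for X i
        by (auto simp: force_def fun_eq_iff)
      have "(\<Sum>y\<in>?Y. out (force (Suc k) (w(k := y))) - out (force k (w(k := y))))
              = (\<Sum>X\<in>Pow {..<B}. \<Sum>i<B. g' (m (insert i X)) i - g' (m (X - {i})) i)"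
        unfolding sum.cartesian_product
        by (intro sum.cong) (auto simp: f1 f2 g' subset_iff)
      also have "\<dots> = (\<Sum>i<B. \<Sum>X\<in>Pow {..<B}. g' (m (insert i X)) i - g' (m (X - {i})) i)"
        by (rule sum.swap)
      also have "\<dots> = (\<Sum>i<B. 2 * (\<Sum>X\<in>Pow {..<B}. if i \<in> X then g' (m X) i else - g' (m X) i))"
        by (intro sum.cong sum_Pow_insert_minus_remove) auto
      also have "\<dots> = 2 * (\<Sum>X\<in>Pow {..<B}. \<Sum>i<B. if i \<in> X then g' (m X) i else - g' (m X) i)"
        by (simp add: sum_distrib_left[symmetric] sum.swap[of _ "{..<B}"])
      finally show ?thesis
        using index_advantage_le[of "{..<B}" Q m g' lam] mQ Q l
        by (simp add: g'_def E_def)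
    qed
    have "2 ^ B * (lam * B * (\<Sum>w\<in>?W. out (force (Suc k) w) - out (force k w)))
        = (\<Sum>w\<in>?W. lam * (\<Sum>y\<in>?Y. out (force (Suc k) (w(k := y))) - out (force k (w(k := y)))))"
      using sum_chain_inputs_resample[OF k, where f = "\<lambda>w. out (force (Suc k) w) - out (force k w)" and B = B]
      by (simp only: sum_distrib_left[symmetric]) simp
    also have "\<dots> \<le> (\<Sum>w\<in>?W. 2 * (2 ^ B * E))"
      by (intro sum_mono *)
    also have "\<dots> = 2 ^ B * (2 * card ?W * E)"
      by simp
    finally show ?thesis by simp
  qed
  have "lam * B * (\<Sum>w\<in>?W. out (force J w) - out (force 0 w))
      = (\<Sum>k<J. lam * B * (\<Sum>w\<in>?W. out (force (Suc k) w) - out (force k w)))"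
  proof -
    have "out (force J w) - out (force 0 w) = (\<Sum>k<J. out (force (Suc k) w) - out (force k w))" for w
      by (rule sum_lessThan_telescope[of "\<lambda>k. out (force k w)", symmetric])
    then show ?thesis
      by (simp add: sum_distrib_left[symmetric] sum.swap[of _ _ "{..<J}"])
  qed
  also have "\<dots> \<le> (\<Sum>k<J. 2 * card ?W * E)"
    by (intro sum_mono step) auto
  also have "\<dots> = 2 * J * card ?W * E"
    by simp
  finally show ?thesis by (simp add: E_def)
qed

section \<open>Intersection graphs of equal squares\<close>

definition touching :: "ereal \<Rightarrow> ('d::finite) lball \<Rightarrow> 'd lball \<Rightarrow> bool" where
  "touching p b b' \<longleftrightarrow> lp_norm p (real_centre b - real_centre b') \<le> real (snd b) + real (snd b')"

lemma finite_independent_sets: "finite (fst G) \<Longrightarrow> finite {S. independent_set G S}"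
  by (rule finite_subset[of _ "Pow (fst G)"]) (auto simp: independent_set_def)

lemma independence_number_ge:
  "finite (fst G) \<Longrightarrow> independent_set G S \<Longrightarrow> card S \<le> independence_number G"
  unfolding independence_number_def by (intro Max_ge finite_imageI finite_independent_sets) auto

lemma independence_number_le:
  assumes "finite (fst G)" "\<And>S. independent_set G S \<Longrightarrow> card S \<le> c"
  shows "independence_number G \<le> c"
proof -
  have "independent_set G {}" by (simp add: independent_set_def)
  then show ?thesis
    unfolding independence_number_def using assms
    by (subst Max_le_iff) (auto intro: finite_independent_sets)
qed

text \<open>Choosing one position for each ball turns pairwise disjoint balls into an independent
  set of positions, however often a ball is repeated.\<close>

lemma card_le_independence_number:
  assumes "C \<subseteq> set bs" "\<And>b b'. b \<in> C \<Longrightarrow> b' \<in> C \<Longrightarrow> b \<noteq> b' \<Longrightarrow> \<not> touching p b b'"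
  shows "card C \<le> independence_number (intersection_graph p bs)"
proof -
  have "\<forall>b\<in>C. \<exists>i<length bs. bs ! i = b"
    using assms(1) by (auto simp: in_set_conv_nth subset_iff)
  then obtain f where f: "\<And>b. b \<in> C \<Longrightarrow> f b < length bs \<and> bs ! f b = b"
    by metis
  have inj: "inj_on f C"
    by (rule inj_onI) (metis f)
  have "independent_set (intersection_graph p bs) (f ` C)"
    unfolding independent_set_def
  proof (intro conjI ballI)
    show "f ` C \<subseteq> fst (intersection_graph p bs)"
      using f by (auto simp: intersection_graph_def)
    fix u v assume uv: "u \<in> f ` C" "v \<in> f ` C"
    show "{u, v} \<notin> snd (intersection_graph p bs)"
    proof
      assume "{u, v} \<in> snd (intersection_graph p bs)"
      then obtain i j where ij: "{u, v} = {i, j}" "i \<noteq> j" "touching p (bs ! i) (bs ! j)"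
        by (auto simp: intersection_graph_def touching_def)
      then have "i \<in> f ` C" "j \<in> f ` C"
        using uv by (auto simp: doubleton_eq_iff)
      then obtain b b' where "b \<in> C" "b' \<in> C" "i = f b" "j = f b'"
        by auto
      then show False
        using ij f[of b] f[of b'] assms(2)[of b b'] by auto
    qed
  qed
  then have "card (f ` C) \<le> independence_number (intersection_graph p bs)"
    by (intro independence_number_ge) (auto simp: intersection_graph_def)
  then show ?thesis
    by (simp add: card_image inj)
qed

text \<open>An independent set has at most one position in each class \<open>P v\<close>. The clique
  condition covers \<open>b = b'\<close>, so two positions holding the same ball are also
  excluded.\<close>

lemma independence_number_le_clique_cover:
  assumes V: "finite V" and cover: "\<And>b. b \<in> set bs \<Longrightarrow> \<exists>v\<in>V. P v b"
    and clique: "\<And>v b b'. P v b \<Longrightarrow> P v b' \<Longrightarrow> touching p b b'"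
  shows "independence_number (intersection_graph p bs) \<le> card V"
proof (rule independence_number_le)
  show "finite (fst (intersection_graph p bs))"
    by (simp add: intersection_graph_def)
  fix S assume S: "independent_set (intersection_graph p bs) S"
  then have len: "i < length bs" if "i \<in> S" for i
    using that by (auto simp: independent_set_def intersection_graph_def)
  then obtain f where f: "\<And>i. i \<in> S \<Longrightarrow> f i \<in> V \<and> P (f i) (bs ! i)"
    using cover[OF nth_mem] by metis
  have "inj_on f S"
  proof (rule inj_onI, rule ccontr)
    fix i j assume ij: "i \<in> S" "j \<in> S" "f i = f j" "i \<noteq> j"
    then have "touching p (bs ! i) (bs ! j)"
      using f[of i] f[of j] clique by metis
    then have "{i, j} \<in> snd (intersection_graph p bs)"
      using ij len by (auto simp: intersection_graph_def touching_def)
    then show False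
      using S ij by (auto simp: independent_set_def)
  qed
  then show "card S \<le> card V"
    using f V by (intro card_inj_on_le[of f]) auto
qed

text \<open>For \<open>p = 1\<close> the plane is rotated by 45 degrees, which doubles the distances; \<open>C\<close> keeps the
  coordinates positive.\<close>
definition place :: "ereal \<Rightarrow> int \<Rightarrow> int \<Rightarrow> int \<times> int \<Rightarrow> 2 lball" where
  "place p C r a =
     (if p = 1 then (\<chi> i. nat (if i = 1 then fst a + snd a else fst a - snd a + C), nat (2 * r))
      else (\<chi> i. nat (if i = 1 then fst a else snd a), nat r))"

definition in_frame :: "int \<Rightarrow> int \<times> int \<Rightarrow> bool" where
  "in_frame C a \<longleftrightarrow> 1 \<le> fst a \<and> fst a \<le> C \<and> 1 \<le> snd a \<and> snd a \<le> C"

text \<open>\<open>in_frame\<close> keeps all coordinates of the centres positive, so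
  \<open>nat\<close> cuts nothing off. For \<open>p = 1\<close> the radius \<open>2 * r\<close>
  matches the doubled distances.\<close>

lemma touching_place_iff:
  assumes "p = 1 \<or> p = \<infinity>" "0 \<le> r" "in_frame C a" "in_frame C b"
  shows "touching p (place p C r a) (place p C r b) \<longleftrightarrow>
    \<bar>fst a - fst b\<bar> \<le> 2 * r \<and> \<bar>snd a - snd b\<bar> \<le> 2 * r"
proof (cases "p = 1")
  case True
  define u v where "u = fst a - fst b" and "v = snd a - snd b"
  have "lp_norm p (real_centre (place p C r a) - real_centre (place p C r b))
      = real_of_int (\<bar>u + v\<bar> + \<bar>u - v\<bar>)"
    using assms(3,4) True
    by (simp add: lp_norm_def real_centre_def place_def sum_2 in_frame_def u_def v_def algebra_simps)
  then have "touching p (place p C r a) (place p C r b) \<longleftrightarrow> real_of_int (\<bar>u + v\<bar> + \<bar>u - v\<bar>) \<le> real_of_int (4 * r)"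
    using True assms(2) by (simp add: touching_def place_def)
  also have "\<dots> \<longleftrightarrow> \<bar>u + v\<bar> + \<bar>u - v\<bar> \<le> 4 * r"
    by (rule of_int_le_iff)
  \<comment> \<open>The sum on the left is twice the larger of \<open>\<bar>u\<bar>\<close> and
    \<open>\<bar>v\<bar>\<close>.\<close>
  also have "\<dots> \<longleftrightarrow> \<bar>u\<bar> \<le> 2 * r \<and> \<bar>v\<bar> \<le> 2 * r"
    by arith
  finally show ?thesis by (simp add: u_def v_def)
next
  case False
  with assms have p: "p = \<infinity>" by simp
  have "lp_norm p (real_centre (place p C r a) - real_centre (place p C r b))
      = real_of_int (max \<bar>fst a - fst b\<bar> \<bar>snd a - snd b\<bar>)"
    using assms(3,4) p
    by (simp add: lp_norm_def infnorm_2 real_centre_def place_def in_frame_def)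
  then have "touching p (place p C r a) (place p C r b) \<longleftrightarrow>
      real_of_int (max \<bar>fst a - fst b\<bar> \<bar>snd a - snd b\<bar>) \<le> real_of_int (2 * r)"
    using False assms(2) by (simp add: touching_def place_def)
  then show ?thesis
    by (simp only: of_int_le_iff) simp
qed

text \<open>Rotated coordinates and radii reach up to \<open>2 * C\<close>, whence the bound on
  \<open>M\<close>.\<close>

lemma place_in_range:
  assumes "1 \<le> r" "r \<le> C" "in_frame C a" "2 * C \<le> int M"
  shows "fst (place p C r a) $ i \<in> {1..M}" "snd (place p C r a) \<in> {1..M}"
  using assms by (auto simp: place_def in_frame_def)

lemma snd_place: "snd (place p C r a) = snd (place p C r b)"
  by (simp add: place_def)

section \<open>The perturbed ladder\<close>

text \<open>
  Member \<open>p\<close> of cluster \<open>j\<close> is displaced from the unit grid by \<open>offset d L B s j p\<close>, where \<open>s\<close> lists the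
  hidden members. The geometric decay of \<open>step\<close> puts every later cluster strictly between the hidden
  member \<open>s i\<close> of cluster \<open>i\<close> and the next one.
\<close>
definition step :: "nat \<Rightarrow> nat \<Rightarrow> nat \<Rightarrow> int" where
  "step L B i = (2 * int B + 2) ^ (3 * L + 3 - i)"

definition radius :: "nat \<Rightarrow> nat \<Rightarrow> int" where
  "radius L B = 4 * (2 * int B + 2) ^ (3 * L + 4)"

text \<open>Members of cluster \<open>i\<close> are \<open>2 * step L B i\<close> apart. The origin
  of the next cluster is the hidden member shifted by half that spacing, which is the summand
  1.\<close>

definition drift :: "(nat \<Rightarrow> int) \<Rightarrow> nat \<Rightarrow> nat \<Rightarrow> (nat \<Rightarrow> nat) \<Rightarrow> nat \<Rightarrow> int" where
  "drift d L B s j = (\<Sum>i<j. step L B i * (1 + 2 * d i * int (s i)))"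

definition offset :: "(nat \<Rightarrow> int) \<Rightarrow> nat \<Rightarrow> nat \<Rightarrow> (nat \<Rightarrow> nat) \<Rightarrow> nat \<Rightarrow> nat \<Rightarrow> int" where
  "offset d L B s j p = drift d L B s j + 2 * d j * step L B j * int p"

lemma step_pos: "0 < step L B i"
  by (simp add: step_def)

lemma step_rec: "i < 3 * L + 3 \<Longrightarrow> step L B i = (2 * int B + 2) * step L B (Suc i)"
  by (simp add: step_def Suc_diff_Suc flip: power_Suc)

lemma abs_sign_mult_le:
  fixes d :: int
  assumes "\<bar>d\<bar> \<le> 1" "p < B" "0 \<le> h"
  shows "\<bar>2 * d * h * int p\<bar> \<le> h * (2 * int B - 2)"
proof -
  have "\<bar>d\<bar> * int p \<le> 1 * (int B - 1)"
    using assms by (intro mult_mono) auto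
  then have "2 * h * (\<bar>d\<bar> * int p) \<le> 2 * h * (int B - 1)"
    using assms by (intro mult_left_mono) auto
  then show ?thesis
    using assms by (simp add: abs_mult algebra_simps)
qed

text \<open>Invariant for nested intervals of half-width \<open>b\<close> around \<open>c\<close>:
  the drift keeps a margin of \<open>2 * B + 2\<close> steps. Passing to the next cluster uses at
  most \<open>2 * B - 1\<close> of them, and a single remaining step is already the required margin
  in terms of the next, smaller step.\<close>

lemma drift_Suc_bound:
  assumes d: "\<And>i. \<bar>d i\<bar> \<le> 1" and s: "\<And>i. s i < B" and k: "k < 3 * L + 3"
    and *: "\<bar>drift d L B s k - c\<bar> \<le> b - (2 * int B + 2) * step L B k"
  shows "\<bar>drift d L B s (Suc k) - c\<bar> \<le> b - (2 * int B + 2) * step L B (Suc k)"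
proof -
  have "\<bar>2 * d k * step L B k * int (s k)\<bar> \<le> step L B k * (2 * int B - 2)"
    using d s step_pos[of L B k] by (intro abs_sign_mult_le) auto
  moreover have "drift d L B s (Suc k) = drift d L B s k + step L B k + 2 * d k * step L B k * int (s k)"
    by (simp add: drift_def algebra_simps)
  ultimately show ?thesis
    using * step_rec[OF k] step_pos[of L B k] by (simp add: algebra_simps)
qed

lemma offset_bound:
  assumes d: "\<And>i. \<bar>d i\<bar> \<le> 1" and s: "\<And>i. s i < B" and p: "p < B"
    and *: "\<bar>drift d L B s k - c\<bar> \<le> b - (2 * int B + 2) * step L B k"
  shows "\<bar>offset d L B s k p - c\<bar> \<le> b - step L B k"
proof -
  have "\<bar>2 * d k * step L B k * int p\<bar> \<le> step L B k * (2 * int B - 2)"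
    using d p step_pos[of L B k] by (intro abs_sign_mult_le) auto
  then show ?thesis
    using * step_pos[of L B k] by (simp add: offset_def algebra_simps)
qed

text \<open>The invariant is started with equality at cluster \<open>Suc i\<close>, with half-width
  \<open>step L B i\<close> around the point one step beyond the hidden member of cluster
  \<open>i\<close>. The signs \<open>d\<close> of the later clusters do not affect the
  bounds.\<close>

lemma offset_diff_bounds:
  assumes d: "\<And>i. \<bar>d i\<bar> \<le> 1" and s: "\<And>i. s i < B" and p: "p < B" and "i < k" "k < 3 * L + 3"
  shows "step L B k \<le> offset d L B s k p - offset d L B s i (s i)"
    and "offset d L B s k p - offset d L B s i (s i) \<le> 2 * step L B i - step L B k"
proof -
  have "Suc i \<le> k" using \<open>i < k\<close> by simp
  then have "\<bar>drift d L B s k - (offset d L B s i (s i) + step L B i)\<bar>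
      \<le> step L B i - (2 * int B + 2) * step L B k"
    using \<open>k < 3 * L + 3\<close>
  proof (induction k rule: dec_induct)
    case base
    then show ?case
      by (simp add: offset_def drift_def algebra_simps step_rec[of i])
  next
    case (step k)
    then show ?case
      by (intro drift_Suc_bound d s) auto
  qed
  then have "\<bar>offset d L B s k p - (offset d L B s i (s i) + step L B i)\<bar> \<le> step L B i - step L B k"
    by (intro offset_bound d s p)
  then show "step L B k \<le> offset d L B s k p - offset d L B s i (s i)"
    and "offset d L B s k p - offset d L B s i (s i) \<le> 2 * step L B i - step L B k"
    by auto
qed

text \<open>The same invariant around 0. The range of \<open>k\<close> includes virtual clusters
  from \<open>3 * L\<close> on; two of them fix the joints at the right end of the ladder.\<close>

lemma abs_offset_le:
  assumes d: "\<And>i. \<bar>d i\<bar> \<le> 1" and s: "\<And>i. s i < B" and p: "p < B" and "k < 3 * L + 3"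
  shows "4 * \<bar>offset d L B s k p\<bar> + 4 * step L B k \<le> radius L B"
proof -
  have "\<bar>drift d L B s k - 0\<bar> \<le> (2 * int B + 2) ^ (3 * L + 4) - (2 * int B + 2) * step L B k"
    using \<open>k < 3 * L + 3\<close>
  proof (induction k)
    case 0
    then show ?case by (simp add: drift_def step_def flip: power_Suc)
  next
    case (Suc k)
    then show ?case by (intro drift_Suc_bound d s) auto
  qed
  then have "\<bar>offset d L B s k p - 0\<bar> \<le> (2 * int B + 2) ^ (3 * L + 4) - step L B k"
    by (intro offset_bound d s p)
  then show ?thesis by (simp add: radius_def)
qed

lemma offset_eq: "offset d L B s j p = offset d L B s j q + 2 * d j * step L B j * (int p - int q)"
  by (simp add: offset_def algebra_simps)

text \<open>
  Cluster \<open>3 t\<close> is the rung \<open>t\<close>, clusters \<open>3 t + 1\<close> and \<open>3 t + 2\<close> are the pieces of the upper and the lower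
  rail to its right. The square of side \<open>2 r\<close> is given by its centre. Rungs move along the falling
  diagonal, rails along the rising one.
\<close>
definition dirx :: "nat \<Rightarrow> int" where
  "dirx j = (if j mod 3 = 0 then - 1 else 1)"

definition diry :: "nat \<Rightarrow> int" where
  "diry j = 1"

definition ladder_square :: "nat \<Rightarrow> nat \<Rightarrow> (nat \<Rightarrow> nat) \<Rightarrow> nat \<Rightarrow> nat \<Rightarrow> int \<times> int" where
  "ladder_square L B s j p =
     (2 * radius L B * (int (j div 3) + (if j mod 3 = 2 then 3 else 2)) + offset dirx L B s j p,
      2 * radius L B * (int (j div 3) + (if j mod 3 = 1 then 4 else 3)) + offset diry L B s j p)"

text \<open>The cap keeps a gap of one step, half the spacing, from the hidden member of its rail:
  that member misses the cap, while the members before it reach over the corner of the cap. The same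
  holds for \<open>lower_cap\<close>, in the other coordinate.\<close>

definition upper_cap :: "nat \<Rightarrow> nat \<Rightarrow> (nat \<Rightarrow> nat) \<Rightarrow> nat \<Rightarrow> int \<times> int" where
  "upper_cap L B s t =
     (2 * radius L B * (int t + 1) + offset dirx L B s (3 * t + 1) (s (3 * t + 1)) - step L B (3 * t + 1),
      2 * radius L B * (int t + 4) + offset diry L B s (3 * t + 1) (s (3 * t + 1)))"

definition lower_cap :: "nat \<Rightarrow> nat \<Rightarrow> (nat \<Rightarrow> nat) \<Rightarrow> nat \<Rightarrow> int \<times> int" where
  "lower_cap L B s t =
     (2 * radius L B * (int t + 3) + offset dirx L B s (3 * t + 2) (s (3 * t + 2)),
      2 * radius L B * (int t + 2) + offset diry L B s (3 * t + 2) (s (3 * t + 2)) - step L B (3 * t + 2))"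

text \<open>The remote square stands for absent members and pads the stream.\<close>
definition remote :: "nat \<Rightarrow> nat \<Rightarrow> int \<times> int" where
  "remote L B = (2 * radius L B * (int L + 10), 2 * radius L B)"

definition apart :: "int \<Rightarrow> int \<times> int \<Rightarrow> int \<times> int \<Rightarrow> bool" where
  "apart r a b \<longleftrightarrow> 2 * r < \<bar>fst a - fst b\<bar> \<or> 2 * r < \<bar>snd a - snd b\<bar>"

definition pierced :: "int \<Rightarrow> int \<times> int \<Rightarrow> int \<times> int \<Rightarrow> bool" where
  "pierced r c a \<longleftrightarrow> \<bar>fst a - fst c\<bar> \<le> r \<and> \<bar>snd a - snd c\<bar> \<le> r"

lemma pierced_imp_not_apart: "pierced r c a \<Longrightarrow> pierced r c b \<Longrightarrow> \<not> apart r a b"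
  by (auto simp: pierced_def apart_def)

text \<open>Kinds 0, 1, 2 are the hidden members of a rung and its two rails, kinds 3 and 4 the caps.\<close>
definition target :: "nat \<Rightarrow> nat \<Rightarrow> (nat \<Rightarrow> nat) \<Rightarrow> nat \<Rightarrow> nat \<Rightarrow> int \<times> int" where
  "target L B s c t =
     (if c < 3 then ladder_square L B s (3 * t + c) (s (3 * t + c))
      else if c = 3 then upper_cap L B s t else lower_cap L B s t)"

lemma abs_dir_le: "\<bar>dirx i\<bar> \<le> 1" "\<bar>diry i\<bar> \<le> 1"
  by (auto simp: dirx_def diry_def)

lemma apart_sym: "apart r a b \<longleftrightarrow> apart r b a"
  by (auto simp: apart_def)

lemma radius_pos: "0 < radius L B"
  by (simp add: radius_def)

text \<open>Unperturbed grid cells of the five kinds relative to column \<open>t\<close>, in units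
  of the side of a square.\<close>

definition cellx :: "nat \<Rightarrow> int" where
  "cellx c = [2, 2, 3, 1, 3] ! c"

definition celly :: "nat \<Rightarrow> int" where
  "celly c = [3, 4, 3, 4, 2] ! c"

lemma less_5_cases: "a < 5 \<Longrightarrow> a = 0 \<or> a = 1 \<or> a = 2 \<or> a = 3 \<or> a = 4" for a :: nat
  by auto

lemma apartI:
  "2 * q < fst b - fst a \<Longrightarrow> apart q a b"
  "2 * q < snd b - snd a \<Longrightarrow> apart q a b"
  "2 * q < fst a - fst b \<Longrightarrow> apart q a b"
  "2 * q < snd a - snd b \<Longrightarrow> apart q a b"
  by (auto simp: apart_def)

lemma remote_in_frame: "in_frame (2 * radius L B * (int L + 11)) (remote L B)"
proof -
  have "0 \<le> radius L B * int L"
    using radius_pos[of L B] by (intro mult_nonneg_nonneg) auto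
  then show ?thesis
    using radius_pos[of L B] unfolding in_frame_def remote_def fst_conv snd_conv ring_distribs
    by (intro conjI) linarith+
qed

section \<open>Disjointness of the hidden members and the caps\<close>

context
  fixes L B :: nat and s :: "nat \<Rightarrow> nat"
  assumes s: "\<And>i. s i < B"
begin

lemmas diffx = offset_diff_bounds[where d = dirx and L = L and B = B and s = s, OF abs_dir_le(1) s]
lemmas diffy = offset_diff_bounds[where d = diry and L = L and B = B and s = s, OF abs_dir_le(2) s]
lemmas absx = abs_offset_le[where d = dirx and L = L and B = B and s = s, OF abs_dir_le(1) s]
lemmas absy = abs_offset_le[where d = diry and L = L and B = B and s = s, OF abs_dir_le(2) s]

abbreviation "xpos j \<equiv> offset dirx L B s j (s j)"
abbreviation "ypos j \<equiv> offset diry L B s j (s j)"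
abbreviation "rad \<equiv> radius L B"

lemma xpos_less: "i < k \<Longrightarrow> k < 3 * L + 3 \<Longrightarrow> xpos i < xpos k"
  using diffx(1)[OF s[of k], of i k] step_pos[of L B k] by simp

lemma ypos_less: "i < k \<Longrightarrow> k < 3 * L + 3 \<Longrightarrow> ypos i < ypos k"
  using diffy(1)[OF s[of k], of i k] step_pos[of L B k] by simp

text \<open>The product \<open>rad * int t\<close> is kept as a single atom, so that all comparisons
  become linear.\<close>

lemma target_coords:
  "fst (target L B s 0 t) = 2 * (rad * int t) + 4 * rad + xpos (3 * t)"
  "snd (target L B s 0 t) = 2 * (rad * int t) + 6 * rad + ypos (3 * t)"
  "fst (target L B s 1 t) = 2 * (rad * int t) + 4 * rad + xpos (3 * t + 1)"
  "snd (target L B s 1 t) = 2 * (rad * int t) + 8 * rad + ypos (3 * t + 1)"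
  "fst (target L B s 2 t) = 2 * (rad * int t) + 6 * rad + xpos (3 * t + 2)"
  "snd (target L B s 2 t) = 2 * (rad * int t) + 6 * rad + ypos (3 * t + 2)"
  "fst (target L B s 3 t) = 2 * (rad * int t) + 2 * rad + xpos (3 * t + 1) - step L B (3 * t + 1)"
  "snd (target L B s 3 t) = 2 * (rad * int t) + 8 * rad + ypos (3 * t + 1)"
  "fst (target L B s 4 t) = 2 * (rad * int t) + 6 * rad + xpos (3 * t + 2)"
  "snd (target L B s 4 t) = 2 * (rad * int t) + 4 * rad + ypos (3 * t + 2) - step L B (3 * t + 2)"
proof -
  have "(3 * t + 1) mod 3 = 1" "(3 * t + 2) mod 3 = 2" "(3 * t + 1) div 3 = t" "(3 * t + 2) div 3 = t"
    by presburger+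
  then show
  "fst (target L B s 0 t) = 2 * (rad * int t) + 4 * rad + xpos (3 * t)"
  "snd (target L B s 0 t) = 2 * (rad * int t) + 6 * rad + ypos (3 * t)"
  "fst (target L B s 1 t) = 2 * (rad * int t) + 4 * rad + xpos (3 * t + 1)"
  "snd (target L B s 1 t) = 2 * (rad * int t) + 8 * rad + ypos (3 * t + 1)"
  "fst (target L B s 2 t) = 2 * (rad * int t) + 6 * rad + xpos (3 * t + 2)"
  "snd (target L B s 2 t) = 2 * (rad * int t) + 6 * rad + ypos (3 * t + 2)"
  "fst (target L B s 3 t) = 2 * (rad * int t) + 2 * rad + xpos (3 * t + 1) - step L B (3 * t + 1)"
  "snd (target L B s 3 t) = 2 * (rad * int t) + 8 * rad + ypos (3 * t + 1)"
  "fst (target L B s 4 t) = 2 * (rad * int t) + 6 * rad + xpos (3 * t + 2)"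
  "snd (target L B s 4 t) = 2 * (rad * int t) + 4 * rad + ypos (3 * t + 2) - step L B (3 * t + 2)"
    by (simp_all add: target_def ladder_square_def upper_cap_def lower_cap_def ring_distribs del: add_2_eq_Suc' add_2_eq_Suc)
qed

lemma small:
  assumes "j < 3 * L + 3" "p < B"
  shows "4 * offset dirx L B s j p < rad" "- rad < 4 * offset dirx L B s j p"
    "4 * offset diry L B s j p < rad" "- rad < 4 * offset diry L B s j p" "4 * step L B j \<le> rad"
  using absx[OF assms(2,1)] absy[OF assms(2,1)] step_pos[of L B j] by auto

text \<open>The perturbation stays below half the radius; doubling avoids a division.\<close>

lemma target_near_cell:
  assumes "c < 5" "t \<le> L"
  shows "\<bar>2 * fst (target L B s c t) - 4 * rad * (int t + cellx c)\<bar> < rad"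
    and "\<bar>2 * snd (target L B s c t) - 4 * rad * (int t + celly c)\<bar> < rad"
proof -
  let ?P = "\<lambda>c. \<bar>2 * fst (target L B s c t) - 4 * rad * (int t + cellx c)\<bar> < rad \<and>
    \<bar>2 * snd (target L B s c t) - 4 * rad * (int t + celly c)\<bar> < rad"
  have sm: "\<bar>2 * xpos j\<bar> < rad" "\<bar>2 * ypos j\<bar> < rad" "\<bar>2 * xpos j - 2 * step L B j\<bar> < rad" "\<bar>2 * ypos j - 2 * step L B j\<bar> < rad"
    if "j < 3 * L + 3" for j
    using small[OF that s[of j]] step_pos[of L B j] by (simp_all add: abs_less_iff)
  have "3 * t < 3 * L + 3" "3 * t + 1 < 3 * L + 3" "3 * t + 2 < 3 * L + 3"
    using assms by auto
  note sm = sm[OF this(1)] sm[OF this(2)] sm[OF this(3)]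
  have "?P 0"
    using sm(1,2) by (simp only: target_coords) (simp add: cellx_def celly_def ring_distribs)
  moreover have "?P 1"
    using sm(5,6) by (simp only: target_coords) (simp add: cellx_def celly_def ring_distribs)
  moreover have "?P 2"
    using sm(9,10) by (simp only: target_coords) (simp add: cellx_def celly_def ring_distribs)
  moreover have "?P 3"
    using sm(6,7) by (simp only: target_coords) (simp add: cellx_def celly_def ring_distribs)
  moreover have "?P 4"
    using sm(9,12) by (simp only: target_coords) (simp add: cellx_def celly_def ring_distribs)
  ultimately have "?P c"
    using less_5_cases[OF assms(1)] by metis
  then show "\<bar>2 * fst (target L B s c t) - 4 * rad * (int t + cellx c)\<bar> < rad"
    and "\<bar>2 * snd (target L B s c t) - 4 * rad * (int t + celly c)\<bar> < rad"
    by auto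
qed

text \<open>Centres of cells two apart in some coordinate differ there by more than
  \<open>4 * rad - rad\<close>, whatever the perturbation.\<close>

lemma target_far:
  assumes "c < 5" "t \<le> L" "c' < 5" "t' \<le> L"
    and "2 \<le> int t' + cellx c' - (int t + cellx c) \<or> 2 \<le> int t' + celly c' - (int t + celly c)"
  shows "apart rad (target L B s c t) (target L B s c' t')"
proof -
  have "8 * rad \<le> 4 * rad * (int t' + a' - (int t + a))" if "2 \<le> int t' + a' - (int t + a)" for a a'
    using mult_left_mono[OF that, of "4 * rad"] radius_pos[of L B] by simp
  note * = this[unfolded right_diff_distrib]
  from assms(5) show ?thesis
  proof
    assume "2 \<le> int t' + cellx c' - (int t + cellx c)"
    from *[OF this] target_near_cell(1)[OF assms(1,2)] target_near_cell(1)[OF assms(3,4)]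
    show ?thesis by (intro apartI(1)) linarith
  next
    assume "2 \<le> int t' + celly c' - (int t + celly c)"
    from *[OF this] target_near_cell(2)[OF assms(1,2)] target_near_cell(2)[OF assms(3,4)]
    show ?thesis by (intro apartI(2)) linarith
  qed
qed

text \<open>For neighbouring cells of one column, the square of the later cluster (a cap counting
  with its rail) lies to the right or above, where its larger displacement opens a gap. A cap and
  its own rail are separated by the extra step.\<close>

lemma target_apart_same:
  assumes "c < c'" "c' < 5" and t: "t \<le> L"
  shows "apart rad (target L B s c t) (target L B s c' t)"
proof -
  have *: "xpos (3 * t) < xpos (3 * t + 1)" "xpos (3 * t + 1) < xpos (3 * t + 2)" "xpos (3 * t) < xpos (3 * t + 2)"
    "ypos (3 * t) < ypos (3 * t + 1)" "ypos (3 * t + 1) < ypos (3 * t + 2)"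
    using t by (auto intro!: xpos_less ypos_less)
  note st = step_pos[of L B "3 * t + 1"] step_pos[of L B "3 * t + 2"]
  consider "c = 0 \<and> c' = 1" | "c = 0 \<and> c' = 2" | "c = 0 \<and> c' = 3" | "c = 0 \<and> c' = 4" | "c = 1 \<and> c' = 2"
    | "c = 1 \<and> c' = 3" | "c = 1 \<and> c' = 4" | "c = 2 \<and> c' = 3" | "c = 2 \<and> c' = 4" | "c = 3 \<and> c' = 4"
    using assms(1) less_5_cases[OF assms(2)] less_5_cases[OF less_trans[OF assms(1,2)]] by (elim disjE; simp)
  then show ?thesis
  proof cases
    case 1
    show ?thesis
      unfolding conjunct1[OF 1] conjunct2[OF 1]
      using * by (intro apartI(2), unfold target_coords) linarith
  next
    case 2
    show ?thesis
      unfolding conjunct1[OF 2] conjunct2[OF 2]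
      using * by (intro apartI(1), unfold target_coords) linarith
  next
    case 3
    show ?thesis
      unfolding conjunct1[OF 3] conjunct2[OF 3]
      using * by (intro apartI(2), unfold target_coords) linarith
  next
    case 4
    show ?thesis
      unfolding conjunct1[OF 4] conjunct2[OF 4]
      using * by (intro apartI(1), unfold target_coords) linarith
  next
    case 5
    show ?thesis
      unfolding conjunct1[OF 5] conjunct2[OF 5]
      using * by (intro apartI(1), unfold target_coords) linarith
  next
    case 6
    show ?thesis
      unfolding conjunct1[OF 6] conjunct2[OF 6]
      using st by (intro apartI(3), unfold target_coords) linarith
  next
    case 7
    then show ?thesis
      using target_far[of 4 t 1 t] t by (subst apart_sym) (simp add: cellx_def celly_def)
  next
    case 8
    then show ?thesis
      using target_far[of 3 t 2 t] t by (subst apart_sym) (simp add: cellx_def celly_def)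
  next
    case 9
    show ?thesis
      unfolding conjunct1[OF 9] conjunct2[OF 9]
      using st by (intro apartI(4), unfold target_coords) linarith
  next
    case 10
    then show ?thesis
      using target_far[of 3 t 4 t] t by (simp add: cellx_def celly_def)
  qed
qed

lemma target_apart_next:
  assumes c: "c < 5" "c' < 5" and t: "Suc t \<le> L"
  shows "apart rad (target L B s c t) (target L B s c' (Suc t))"
proof (cases "2 \<le> 1 + cellx c' - cellx c \<or> 2 \<le> 1 + celly c' - celly c")
  case True
  then show ?thesis
    using target_far[of c t c' "Suc t"] c t by simp
next
  case False
  have *: "xpos (3 * t) < xpos (3 * Suc t)" "xpos (3 * t + 1) < xpos (3 * Suc t)" "xpos (3 * t + 2) < xpos (3 * Suc t + 2)"
    "xpos (3 * t + 1) < xpos (3 * Suc t + 1)"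
    "ypos (3 * t + 2) < ypos (3 * Suc t)" "ypos (3 * t + 1) < ypos (3 * Suc t + 1)"
    using t by (auto intro!: xpos_less ypos_less)
  have rS: "rad * int (Suc t) = rad * int t + rad"
    by (simp add: algebra_simps)
  \<comment> \<open>In the remaining pairs the cell of the later column lies to the right or above,
    so again the growth of the displacements separates the squares.\<close>
  from False have "c = c' \<or> c = 1 \<and> c' = 0 \<or> c = 1 \<and> c' = 3 \<or> c = 2 \<and> c' = 0 \<or> c = 2 \<and> c' = 4"
    using less_5_cases[OF c(1)] less_5_cases[OF c(2)]
    by (elim disjE) (simp_all add: cellx_def celly_def)
  then consider "c = 0 \<and> c' = 0" | "c = 1 \<and> c' = 1" | "c = 2 \<and> c' = 2" | "c = 3 \<and> c' = 3" | "c = 4 \<and> c' = 4"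
    | "c = 1 \<and> c' = 0" | "c = 1 \<and> c' = 3" | "c = 2 \<and> c' = 0" | "c = 2 \<and> c' = 4"
    using less_5_cases[OF c(1)] by (elim disjE; simp)
  then show ?thesis
  proof cases
    case 1
    show ?thesis
      unfolding conjunct1[OF 1] conjunct2[OF 1]
      using * rS by (intro apartI(1), unfold target_coords) linarith
  next
    case 2
    show ?thesis
      unfolding conjunct1[OF 2] conjunct2[OF 2]
      using * rS by (intro apartI(1), unfold target_coords) linarith
  next
    case 3
    show ?thesis
      unfolding conjunct1[OF 3] conjunct2[OF 3]
      using * rS by (intro apartI(1), unfold target_coords) linarith
  next
    case 4
    show ?thesis
      unfolding conjunct1[OF 4] conjunct2[OF 4]
      using * rS by (intro apartI(2), unfold target_coords) linarith
  next
    case 5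
    show ?thesis
      unfolding conjunct1[OF 5] conjunct2[OF 5]
      using * rS by (intro apartI(1), unfold target_coords) linarith
  next
    case 6
    show ?thesis
      unfolding conjunct1[OF 6] conjunct2[OF 6]
      using * rS by (intro apartI(1), unfold target_coords) linarith
  next
    case 7
    show ?thesis
      unfolding conjunct1[OF 7] conjunct2[OF 7]
      using * rS by (intro apartI(2), unfold target_coords) linarith
  next
    case 8
    show ?thesis
      unfolding conjunct1[OF 8] conjunct2[OF 8]
      using * rS by (intro apartI(2), unfold target_coords) linarith
  next
    case 9
    show ?thesis
      unfolding conjunct1[OF 9] conjunct2[OF 9]
      using * rS by (intro apartI(1), unfold target_coords) linarith
  qed
qed

lemma target_apart_later:
  assumes c: "c < 5" "c' < 5" and t: "t + 2 \<le> t'" "t' \<le> L"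
  shows "apart rad (target L B s c t) (target L B s c' t')"
proof (rule target_far)
  show "2 \<le> int t' + cellx c' - (int t + cellx c) \<or> 2 \<le> int t' + celly c' - (int t + celly c)"
    using less_5_cases[OF c(1)] less_5_cases[OF c(2)] t
    by (elim disjE) (simp_all add: cellx_def celly_def)
qed (use assms in auto)

lemma target_apart:
  assumes c: "c < 5" "c' < 5" and t: "t \<le> L" "t' \<le> L" and ne: "(c, t) \<noteq> (c', t')"
  shows "apart rad (target L B s c t) (target L B s c' t')"
proof -
  have less: "apart rad (target L B s a u) (target L B s a' u')" if "a < 5" "a' < 5" "u < u'" "u' \<le> L" for a a' u u'
    using target_apart_next[of a a' u] target_apart_later[of a a' u u'] that
    by (cases "u' = Suc u") auto
  consider "t < t'" | "t' < t" | "t = t' \<and> c < c'" | "t = t' \<and> c' < c"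
    using ne by (cases t t' rule: linorder_cases; cases c c' rule: linorder_cases) auto
  then show ?thesis
    using less[of c c' t t'] less[of c' c t' t] target_apart_same[of c c' t] target_apart_same[of c' c t] c t
    by cases (auto simp: apart_sym)
qed

lemma remote_apart:
  assumes "c < 5" "t < L"
  shows "apart rad (target L B s c t) (remote L B)"
proof (rule apartI(1))
  have "cellx c \<le> 3"
    using less_5_cases[OF assms(1)] by (elim disjE) (simp_all add: cellx_def)
  then have "4 * rad * (int t + cellx c) \<le> 4 * rad * (int L + 3)"
    using assms(2) radius_pos[of L B] by (intro mult_left_mono) auto
  moreover have "\<bar>2 * fst (target L B s c t) - 4 * rad * (int t + cellx c)\<bar> < rad"
    using assms by (intro target_near_cell) auto
  ultimately show "2 * rad < fst (remote L B) - fst (target L B s c t)"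
    using radius_pos[of L B] by (simp add: remote_def ring_distribs)
qed

lemma square_near_cell:
  assumes "j < 3 * L" "p < B"
  shows "\<bar>2 * fst (ladder_square L B s j p) - 4 * rad * (int (j div 3) + cellx (j mod 3))\<bar> < rad"
    and "\<bar>2 * snd (ladder_square L B s j p) - 4 * rad * (int (j div 3) + celly (j mod 3))\<bar> < rad"
proof -
  have j: "j < 3 * L + 3" using assms by simp
  have "cellx (j mod 3) = (if j mod 3 = 2 then 3 else 2)" "celly (j mod 3) = (if j mod 3 = 1 then 4 else 3)"
  proof -
    have "j mod 3 = 0 \<or> j mod 3 = 1 \<or> j mod 3 = 2" by auto
    then show "cellx (j mod 3) = (if j mod 3 = 2 then 3 else 2)" "celly (j mod 3) = (if j mod 3 = 1 then 4 else 3)"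
      by (auto simp: cellx_def celly_def)
  qed
  then have "2 * fst (ladder_square L B s j p) - 4 * rad * (int (j div 3) + cellx (j mod 3)) = 2 * offset dirx L B s j p"
    "2 * snd (ladder_square L B s j p) - 4 * rad * (int (j div 3) + celly (j mod 3)) = 2 * offset diry L B s j p"
    by (simp_all only: ladder_square_def fst_conv snd_conv) (simp_all add: ring_distribs)
  then show "\<bar>2 * fst (ladder_square L B s j p) - 4 * rad * (int (j div 3) + cellx (j mod 3))\<bar> < rad"
    "\<bar>2 * snd (ladder_square L B s j p) - 4 * rad * (int (j div 3) + celly (j mod 3))\<bar> < rad"
    using small[OF j assms(2)] by linarith+
qed

lemma in_frame_near_cell:
  assumes "\<bar>2 * fst a - 4 * rad * (int t + u)\<bar> < rad" "\<bar>2 * snd a - 4 * rad * (int t + v)\<bar> < rad"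
    and "t \<le> L" "1 \<le> u" "u \<le> 4" "1 \<le> v" "v \<le> 4"
  shows "in_frame (2 * rad * (int L + 11)) a"
proof -
  have *: "4 * rad * 1 \<le> 4 * rad * (int t + w)" "4 * rad * (int t + w) \<le> 4 * rad * (int L + 4)" if "1 \<le> w" "w \<le> 4" for w
    using that assms(3) radius_pos[of L B] by (auto intro!: mult_left_mono)
  have frame: "1 \<le> z \<and> z \<le> 2 * rad * (int L + 11)"
    if "\<bar>2 * z - 4 * rad * (int t + w)\<bar> < rad" "1 \<le> w" "w \<le> 4" for z w
  proof -
    have "2 * (2 * rad * (int L + 11)) = 4 * rad * (int L + 4) + 28 * rad"
      by (simp add: ring_distribs)
    then show ?thesis
      using that(1) *[OF that(2,3)] radius_pos[of L B] unfolding abs_less_iff by linarith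
  qed
  show ?thesis
    unfolding in_frame_def using frame assms by blast
qed

lemma square_in_frame:
  assumes "j < 3 * L" "p < B"
  shows "in_frame (2 * rad * (int L + 11)) (ladder_square L B s j p)"
proof -
  have "j mod 3 = 0 \<or> j mod 3 = 1 \<or> j mod 3 = 2" by auto
  then have "1 \<le> cellx (j mod 3)" "cellx (j mod 3) \<le> 4" "1 \<le> celly (j mod 3)" "celly (j mod 3) \<le> 4"
    by (auto simp: cellx_def celly_def)
  moreover have "j div 3 < L"
    using assms by auto
  ultimately show ?thesis
    using square_near_cell[OF assms] by (blast intro: in_frame_near_cell less_imp_le)
qed

lemma target_in_frame:
  assumes "c < 5" "t \<le> L"
  shows "in_frame (2 * rad * (int L + 11)) (target L B s c t)"
proof -
  have "1 \<le> cellx c" "cellx c \<le> 4" "1 \<le> celly c" "celly c \<le> 4"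
    using less_5_cases[OF assms(1)] by (auto simp: cellx_def celly_def)
  then show ?thesis
    using target_near_cell[OF assms] assms by (blast intro: in_frame_near_cell less_imp_le)
qed

section \<open>Piercing all other members by the joints\<close>

definition upper_joint :: "nat \<Rightarrow> int \<times> int" where
  "upper_joint t = (fst (target L B s 3 t) + rad, snd (target L B s 3 t) - rad)"

text \<open>In the unit grid four cells meet at a joint: for column \<open>t\<close> those of the
  cap, the rung and the rail pieces of columns \<open>t - 1\<close> and \<open>t\<close>, taken on
  the upper or the lower side respectively.\<close>

definition lower_joint :: "nat \<Rightarrow> int \<times> int" where
  "lower_joint t = (fst (target L B s 4 t) - rad, snd (target L B s 4 t) + rad)"

lemma cap_pierced:
  "pierced rad (upper_joint t) (target L B s 3 t)" "pierced rad (lower_joint t) (target L B s 4 t)"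
  using radius_pos[of L B] by (auto simp: pierced_def upper_joint_def lower_joint_def)

lemma joint_coords:
  "fst (upper_joint t) = 2 * (rad * int t) + 3 * rad + xpos (3 * t + 1) - step L B (3 * t + 1)"
  "snd (upper_joint t) = 2 * (rad * int t) + 7 * rad + ypos (3 * t + 1)"
  "fst (lower_joint t) = 2 * (rad * int t) + 5 * rad + xpos (3 * t + 2)"
  "snd (lower_joint t) = 2 * (rad * int t) + 5 * rad + ypos (3 * t + 2) - step L B (3 * t + 2)"
  unfolding upper_joint_def lower_joint_def fst_conv snd_conv target_coords by simp_all

lemma square_coords:
  "fst (ladder_square L B s (3 * t) p) = 2 * (rad * int t) + 4 * rad + offset dirx L B s (3 * t) p"
  "snd (ladder_square L B s (3 * t) p) = 2 * (rad * int t) + 6 * rad + offset diry L B s (3 * t) p"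
  "fst (ladder_square L B s (3 * t + 1) p) = 2 * (rad * int t) + 4 * rad + offset dirx L B s (3 * t + 1) p"
  "snd (ladder_square L B s (3 * t + 1) p) = 2 * (rad * int t) + 8 * rad + offset diry L B s (3 * t + 1) p"
  "fst (ladder_square L B s (3 * t + 2) p) = 2 * (rad * int t) + 6 * rad + offset dirx L B s (3 * t + 2) p"
  "snd (ladder_square L B s (3 * t + 2) p) = 2 * (rad * int t) + 6 * rad + offset diry L B s (3 * t + 2) p"
proof -
  have "(3 * t + 1) mod 3 = 1" "(3 * t + 2) mod 3 = 2" "(3 * t + 1) div 3 = t" "(3 * t + 2) div 3 = t"
    by presburger+
  then show
  "fst (ladder_square L B s (3 * t) p) = 2 * (rad * int t) + 4 * rad + offset dirx L B s (3 * t) p"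
  "snd (ladder_square L B s (3 * t) p) = 2 * (rad * int t) + 6 * rad + offset diry L B s (3 * t) p"
  "fst (ladder_square L B s (3 * t + 1) p) = 2 * (rad * int t) + 4 * rad + offset dirx L B s (3 * t + 1) p"
  "snd (ladder_square L B s (3 * t + 1) p) = 2 * (rad * int t) + 8 * rad + offset diry L B s (3 * t + 1) p"
  "fst (ladder_square L B s (3 * t + 2) p) = 2 * (rad * int t) + 6 * rad + offset dirx L B s (3 * t + 2) p"
  "snd (ladder_square L B s (3 * t + 2) p) = 2 * (rad * int t) + 6 * rad + offset diry L B s (3 * t + 2) p"
    by (simp_all add: ladder_square_def ring_distribs del: add_2_eq_Suc' add_2_eq_Suc)
qed

lemma offset_before:
  assumes "p < s j"
  shows "offset diry L B s j p \<le> ypos j - 2 * step L B j"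
    and "dirx j = 1 \<Longrightarrow> offset dirx L B s j p \<le> xpos j - 2 * step L B j"
    and "dirx j = - 1 \<Longrightarrow> xpos j + 2 * step L B j \<le> offset dirx L B s j p"
proof -
  have *: "2 * step L B j * (int p - int (s j)) \<le> 2 * step L B j * (- 1)"
    using assms step_pos[of L B j] by (intro mult_left_mono) auto
  show "offset diry L B s j p \<le> ypos j - 2 * step L B j"
    "dirx j = 1 \<Longrightarrow> offset dirx L B s j p \<le> xpos j - 2 * step L B j"
    "dirx j = - 1 \<Longrightarrow> xpos j + 2 * step L B j \<le> offset dirx L B s j p"
    using * offset_eq[of diry L B s j p "s j"] offset_eq[of dirx L B s j p "s j"]
    by (simp_all add: diry_def)
qed

lemma offset_after:
  assumes "s j < p"
  shows "ypos j + 2 * step L B j \<le> offset diry L B s j p"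
    and "dirx j = 1 \<Longrightarrow> xpos j + 2 * step L B j \<le> offset dirx L B s j p"
    and "dirx j = - 1 \<Longrightarrow> offset dirx L B s j p \<le> xpos j - 2 * step L B j"
proof -
  have *: "2 * step L B j * 1 \<le> 2 * step L B j * (int p - int (s j))"
    using assms step_pos[of L B j] by (intro mult_left_mono) auto
  show "ypos j + 2 * step L B j \<le> offset diry L B s j p"
    "dirx j = 1 \<Longrightarrow> xpos j + 2 * step L B j \<le> offset dirx L B s j p"
    "dirx j = - 1 \<Longrightarrow> offset dirx L B s j p \<le> xpos j - 2 * step L B j"
    using * offset_eq[of diry L B s j p "s j"] offset_eq[of dirx L B s j p "s j"]
    by (simp_all add: diry_def)
qed

lemma dirx_simps: "dirx (3 * t) = - 1" "dirx (3 * t + 1) = 1" "dirx (3 * t + 2) = 1"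
proof -
  have "(3 * t + 1) mod 3 = 1" "(3 * t + 2) mod 3 = 2"
    by presburger+
  then show "dirx (3 * t) = - 1" "dirx (3 * t + 1) = 1" "dirx (3 * t + 2) = 1"
    unfolding dirx_def by simp_all
qed

lemma near_bounds:
  assumes "i < k" "k < 3 * L + 3"
  shows "xpos i + step L B k \<le> xpos k" "xpos k \<le> xpos i + 2 * step L B i" "ypos i + step L B k \<le> ypos k" "ypos k \<le> ypos i + 2 * step L B i"
  using diffx[OF s[of k] assms] diffy[OF s[of k] assms] step_pos[of L B k] by auto

text \<open>A member other than the hidden one is displaced by at least two steps of its cluster,
  and the joint lies within two steps of the corner of the hidden member. On a rail, smaller indices
  move onto joint \<open>t\<close> and larger ones onto joint \<open>Suc t\<close>.\<close>

lemma pierced_upper: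
  assumes t: "t < L" and p: "p < B"
  shows "s (3 * t) < p \<Longrightarrow> pierced rad (upper_joint t) (ladder_square L B s (3 * t) p)"
    and "p < s (3 * t + 1) \<Longrightarrow> pierced rad (upper_joint t) (ladder_square L B s (3 * t + 1) p)"
    and "s (3 * t + 1) < p \<Longrightarrow> pierced rad (upper_joint (Suc t)) (ladder_square L B s (3 * t + 1) p)"
proof -
  have j: "3 * t < 3 * L + 3" "3 * t + 1 < 3 * L + 3" "3 * Suc t + 1 < 3 * L + 3"
    and lt: "3 * t < 3 * t + 1" "3 * t + 1 < 3 * Suc t + 1"
    using t by auto
  have rS: "rad * int (Suc t) = rad * int t + rad"
    by (simp add: algebra_simps)
  note n = near_bounds[OF lt(1) j(2)] and n' = near_bounds[OF lt(2) j(3)]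
    and sm0 = small[OF j(1) p] and sm1 = small[OF j(2) p]
    and st = small[OF j(1) s[of "3 * t"]] small[OF j(2) s[of "3 * t + 1"]] small[OF j(3) s[of "3 * Suc t + 1"]]
    and pos = step_pos[of L B "3 * t"] step_pos[of L B "3 * t + 1"] step_pos[of L B "3 * Suc t + 1"]
  show "pierced rad (upper_joint t) (ladder_square L B s (3 * t) p)" if "s (3 * t) < p"
    using offset_after(1)[OF that] offset_after(3)[OF that dirx_simps(1)] n(1,4) sm0 st(1-10) pos(1,2)
    unfolding pierced_def joint_coords square_coords abs_le_iff by (intro conjI) linarith+
  show "pierced rad (upper_joint t) (ladder_square L B s (3 * t + 1) p)" if "p < s (3 * t + 1)"
    using offset_before(1)[OF that] offset_before(2)[OF that dirx_simps(2)] sm1 st(6-10) pos(2)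
    unfolding pierced_def joint_coords square_coords abs_le_iff by (intro conjI) linarith+
  show "pierced rad (upper_joint (Suc t)) (ladder_square L B s (3 * t + 1) p)" if "s (3 * t + 1) < p"
    using offset_after(1)[OF that] offset_after(2)[OF that dirx_simps(2)] n'(2,4) sm1 st(11-15) pos(3) rS
    unfolding pierced_def joint_coords square_coords abs_le_iff by (intro conjI) linarith+
qed

text \<open>The mirror image: a rung moves along the falling diagonal, so here its smaller indices
  reach the joint.\<close>

lemma pierced_lower:
  assumes t: "t < L" and p: "p < B"
  shows "p < s (3 * t) \<Longrightarrow> pierced rad (lower_joint t) (ladder_square L B s (3 * t) p)"
    and "p < s (3 * t + 2) \<Longrightarrow> pierced rad (lower_joint t) (ladder_square L B s (3 * t + 2) p)"
    and "s (3 * t + 2) < p \<Longrightarrow> pierced rad (lower_joint (Suc t)) (ladder_square L B s (3 * t + 2) p)"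
proof -
  have j: "3 * t < 3 * L + 3" "3 * t + 2 < 3 * L + 3" "3 * Suc t + 2 < 3 * L + 3"
    and lt: "3 * t < 3 * t + 2" "3 * t + 2 < 3 * Suc t + 2"
    using t by auto
  have rS: "rad * int (Suc t) = rad * int t + rad"
    by (simp add: algebra_simps)
  note n = near_bounds[OF lt(1) j(2)] and n' = near_bounds[OF lt(2) j(3)]
    and sm0 = small[OF j(1) p] and sm1 = small[OF j(2) p]
    and st = small[OF j(1) s[of "3 * t"]] small[OF j(2) s[of "3 * t + 2"]] small[OF j(3) s[of "3 * Suc t + 2"]]
    and pos = step_pos[of L B "3 * t"] step_pos[of L B "3 * t + 2"] step_pos[of L B "3 * Suc t + 2"]
  show "pierced rad (lower_joint t) (ladder_square L B s (3 * t) p)" if "p < s (3 * t)"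
    using offset_before(1)[OF that] offset_before(3)[OF that dirx_simps(1)] n(2,3) sm0 st(1-10) pos(1,2)
    unfolding pierced_def joint_coords square_coords abs_le_iff by (intro conjI) linarith+
  show "pierced rad (lower_joint t) (ladder_square L B s (3 * t + 2) p)" if "p < s (3 * t + 2)"
    using offset_before(1)[OF that] offset_before(2)[OF that dirx_simps(3)] sm1 st(6-10) pos(2)
    unfolding pierced_def joint_coords square_coords abs_le_iff by (intro conjI) linarith+
  show "pierced rad (lower_joint (Suc t)) (ladder_square L B s (3 * t + 2) p)" if "s (3 * t + 2) < p"
    using offset_after(1)[OF that] offset_after(2)[OF that dirx_simps(3)] n'(2,4) sm1 st(11-15) pos(3) rS
    unfolding pierced_def joint_coords square_coords abs_le_iff by (intro conjI) linarith+
qed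

lemma square_pierced:
  assumes j: "j < 3 * L" and p: "p < B" "p \<noteq> s j"
  shows "\<exists>t\<le>L. pierced rad (upper_joint t) (ladder_square L B s j p) \<or> pierced rad (lower_joint t) (ladder_square L B s j p)"
proof -
  define t where "t = j div 3"
  have t: "t < L" "Suc t \<le> L" "t \<le> L" and "j = 3 * t \<or> j = 3 * t + 1 \<or> j = 3 * t + 2"
    using j by (auto simp: t_def)
  moreover have "p < s j \<or> s j < p"
    using p(2) by auto
  ultimately show ?thesis
    using pierced_upper[OF t(1) p(1)] pierced_lower[OF t(1) p(1)] t by metis
qed

end

section \<open>The hard streams\<close>

definition frame :: "nat \<Rightarrow> nat \<Rightarrow> int" where
  "frame L B = 2 * radius L B * (int L + 11)"

text \<open>The value 0 serves the virtual clusters of column \<open>L\<close>, which hold no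
  squares of the stream and only position the last joints.\<close>

definition hidden :: "nat \<Rightarrow> (nat \<Rightarrow> nat set \<times> nat) \<Rightarrow> nat \<Rightarrow> nat" where
  "hidden L w i = (if i < 3 * L then snd (w i) else 0)"

text \<open>Each player fills a block of \<open>B\<close> positions, whose squares depend only on
  indices revealed earlier. The caps follow when all indices are known, and the rest is
  padding.\<close>

definition stream_point :: "nat \<Rightarrow> nat \<Rightarrow> (nat \<Rightarrow> nat set \<times> nat) \<Rightarrow> nat \<Rightarrow> int \<times> int" where
  "stream_point L B w i =
     (if i < 3 * L * B then
        if i mod B \<in> fst (w (i div B)) then ladder_square L B (hidden L w) (i div B) (i mod B) else remote L B
      else if i < 3 * L * B + 2 * L then
        target L B (hidden L w) (3 + (i - 3 * L * B) mod 2) ((i - 3 * L * B) div 2)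
      else remote L B)"

definition hard_stream :: "ereal \<Rightarrow> nat \<Rightarrow> nat \<Rightarrow> nat \<Rightarrow> (nat \<Rightarrow> nat set \<times> nat) \<Rightarrow> 2 lball list" where
  "hard_stream p L B n w = map (\<lambda>i. place p (frame L B) (radius L B) (stream_point L B w i)) [0..<n]"

lemma length_hard_stream [simp]: "length (hard_stream p L B n w) = n"
  by (simp add: hard_stream_def)

lemma nth_hard_stream:
  "i < n \<Longrightarrow> hard_stream p L B n w ! i = place p (frame L B) (radius L B) (stream_point L B w i)"
  by (simp add: hard_stream_def)

lemma hidden_less: "0 < B \<Longrightarrow> \<forall>j<3 * L. snd (w j) < B \<Longrightarrow> hidden L w i < B"
  by (simp add: hidden_def)

lemma stream_point_in_frame:
  assumes B: "0 < B" and w: "\<forall>j<3 * L. snd (w j) < B"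
  shows "in_frame (frame L B) (stream_point L B w i)"
proof -
  note s = hidden_less[OF B w]
  have "i div B < 3 * L" if "i < 3 * L * B"
    using that by (simp add: less_mult_imp_div_less)
  then show ?thesis
    unfolding stream_point_def frame_def
    using square_in_frame[of "hidden L w", OF s] target_in_frame[of "hidden L w", OF s] remote_in_frame B
    by auto
qed

lemma radius_le_frame: "1 \<le> radius L B" "radius L B \<le> frame L B"
proof -
  show r: "1 \<le> radius L B"
    using radius_pos[of L B] by simp
  have "radius L B * 1 \<le> radius L B * (2 * (int L + 11))"
    using r by (intro mult_left_mono) auto
  then show "radius L B \<le> frame L B"
    by (simp add: frame_def algebra_simps)
qed

lemma ball_stream_hard_stream:
  assumes "0 < B" "\<forall>j<3 * L. snd (w j) < B" "2 * frame L B \<le> int M"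
  shows "ball_stream n M (hard_stream p L B n w)"
  using place_in_range[OF radius_le_frame stream_point_in_frame[OF assms(1,2)] assms(3)]
  by (auto simp: ball_stream_def hard_stream_def split_beta simp del: atLeastAtMost_iff)

lemma dilation_hard_stream:
  assumes "0 < n"
  shows "dilation (hard_stream p L B n w) = 1"
proof -
  let ?b = "place p (frame L B) (radius L B) (0, 0)"
  have "snd b = snd ?b" if "b \<in> set (hard_stream p L B n w)" for b
    using that by (auto simp: hard_stream_def intro: snd_place)
  moreover have "set (hard_stream p L B n w) \<noteq> {}"
    using assms by (simp add: hard_stream_def)
  ultimately have "snd ` set (hard_stream p L B n w) = {snd ?b}"
    by (metis (no_types, lifting) image_cong image_constant_conv)
  moreover have "0 < snd ?b"
    using radius_pos[of L B] by (simp add: place_def)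
  ultimately show ?thesis
    by (simp add: dilation_def)
qed

text \<open>The independent squares are the five targets of every column and the remote square,
  which occurs because the strict bound on \<open>n\<close> leaves a padding position.\<close>

lemma independence_number_hard_stream_ge:
  assumes p: "p = 1 \<or> p = \<infinity>" and B: "0 < B" and w: "\<forall>j<3 * L. snd (w j) < B"
    and on: "\<forall>j<3 * L. snd (w j) \<in> fst (w j)" and n: "3 * L * B + 2 * L < n"
  shows "5 * L + 1 \<le> independence_number (intersection_graph p (hard_stream p L B n w))"
proof -
  define s where "s = hidden L w"
  have s: "s i < B" for i
    using hidden_less[OF B w] by (simp add: s_def)
  define q where "q = case_option (remote L B) (\<lambda>(c, t). target L B s c t)"
  define I where "I = insert None (Some ` ({..<5::nat} \<times> {..<L}))"
  let ?f = "\<lambda>i. place p (frame L B) (radius L B) (q i)"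
  have frame: "in_frame (frame L B) (q i)" if "i \<in> I" for i
    using that target_in_frame[of s, OF s] remote_in_frame by (auto simp: I_def q_def frame_def)
  have apart: "apart (radius L B) (q i) (q i')" if "i \<in> I" "i' \<in> I" "i \<noteq> i'" for i i'
  proof -
    have remote: "apart (radius L B) (q None) (q i)" "apart (radius L B) (q i) (q None)" if "i \<in> I" "i \<noteq> None" for i
      using that remote_apart[of s, OF s] apart_sym by (auto simp: I_def q_def)
    note ii = that
    show ?thesis
    proof (cases "i = None \<or> i' = None")
      case True
      then show ?thesis using remote ii by metis
    next
      case False
      then obtain c t c' t' where "i = Some (c, t)" "i' = Some (c', t')" "c < 5" "c' < 5" "t < L" "t' < L"
        using ii(1,2) by (auto simp: I_def)
      then show ?thesis
        using ii(3) target_apart[of s, OF s, of c c' t L t'] by (simp add: q_def)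
    qed
  qed
  have not_touching: "\<not> touching p (?f i) (?f i')" if "i \<in> I" "i' \<in> I" "i \<noteq> i'" for i i'
    using touching_place_iff[OF p _ frame[OF that(1)] frame[OF that(2)], of "radius L B"] apart[OF that] radius_pos[of L B]
    by (auto simp: apart_def)
  have touching: "touching p (?f i) (?f i)" if "i \<in> I" for i
    using touching_place_iff[OF p _ frame[OF that] frame[OF that], of "radius L B"] radius_pos[of L B] by auto
  \<comment> \<open>Every ball touches itself, but distinct indices give balls that do not
    touch.\<close>
  have inj: "inj_on ?f I"
    by (rule inj_onI) (metis not_touching touching)
  have in_stream: "?f i \<in> set (hard_stream p L B n w)" if iI: "i \<in> I" for i
  proof -
    have ex: "\<exists>k<n. stream_point L B w k = q i"
    proof (cases i)
      case None
      then show ?thesis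
        using n by (intro exI[of _ "3 * L * B + 2 * L"]) (auto simp: q_def stream_point_def)
    next
      case (Some ct)
      then obtain c t where ct: "i = Some (c, t)" "c < 5" "t < L"
        using iI by (auto simp: I_def)
      show ?thesis
      proof (cases "c < 3")
        case True
        define j where "j = 3 * t + c"
        have j: "j < 3 * L"
          using ct True by (simp add: j_def)
        have "j * B + s j < Suc j * B"
          using s[of j] by simp
        also have "\<dots> \<le> 3 * L * B"
          using j by (intro mult_right_mono) auto
        finally have lt: "j * B + s j < 3 * L * B" .
        moreover have "s j = snd (w j)"
          using j by (simp add: s_def hidden_def)
        moreover have "(j * B + s j) div B = j" "(j * B + s j) mod B = s j"
          using s[of j] by auto
        ultimately show ?thesis
          using on j n ct True
          by (intro exI[of _ "j * B + s j"]) (auto simp: stream_point_def q_def target_def j_def s_def)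
      next
        case False
        then have "c = 3 \<or> c = 4" using ct by auto
        then show ?thesis
          using n ct by (intro exI[of _ "3 * L * B + 2 * t + (c - 3)"])
            (auto simp: stream_point_def q_def s_def)
      qed
    qed
    then obtain k where "k < n" "stream_point L B w k = q i"
      by blast
    then show ?thesis
      using nth_mem[of k "hard_stream p L B n w"] by (simp add: nth_hard_stream)
  qed
  have "card I = 5 * L + 1"
    by (simp add: I_def card_insert_if card_image card_cartesian_product image_iff)
  moreover have "card (?f ` I) \<le> independence_number (intersection_graph p (hard_stream p L B n w))"
  proof (rule card_le_independence_number)
    show "?f ` I \<subseteq> set (hard_stream p L B n w)"
      using in_stream by blast
    fix b b' assume "b \<in> ?f ` I" "b' \<in> ?f ` I" "b \<noteq> b'"
    then show "\<not> touching p b b'"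
      using not_touching by blast
  qed
  ultimately show ?thesis
    by (simp add: card_image[OF inj])
qed

text \<open>The \<open>L + 1\<close> joints on each side pierce everything but the remote squares,
  which form one more clique.\<close>

lemma independence_number_hard_stream_le:
  assumes p: "p = 1 \<or> p = \<infinity>" and B: "0 < B" and w: "\<forall>j<3 * L. snd (w j) < B"
    and off: "\<forall>j<3 * L. snd (w j) \<notin> fst (w j)"
  shows "independence_number (intersection_graph p (hard_stream p L B n w)) \<le> 2 * L + 3"
proof -
  define s where "s = hidden L w"
  have s: "s i < B" for i
    using hidden_less[OF B w] by (simp add: s_def)
  let ?r = "radius L B"
  define V where "V = insert (remote L B) (upper_joint L B s ` {..L} \<union> lower_joint L B s ` {..L})"
  define P where "P v b \<longleftrightarrow> (\<exists>a. b = place p (frame L B) ?r a \<and> in_frame (frame L B) a \<and> pierced ?r v a)" for v b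
  have "independence_number (intersection_graph p (hard_stream p L B n w)) \<le> card V"
  proof (rule independence_number_le_clique_cover[where P = P])
    show "finite V" by (simp add: V_def)
  next
    fix b assume "b \<in> set (hard_stream p L B n w)"
    then obtain i where b: "b = place p (frame L B) ?r (stream_point L B w i)"
      by (auto simp: hard_stream_def)
    have remote: "pierced ?r (remote L B) (remote L B)"
      using radius_pos[of L B] by (simp add: pierced_def)
    have "\<exists>v\<in>V. pierced ?r v (stream_point L B w i)"
    proof -
      consider "stream_point L B w i = remote L B"
        | "i < 3 * L * B" "i mod B \<in> fst (w (i div B))"
            "stream_point L B w i = ladder_square L B s (i div B) (i mod B)"
        | t where "t < L" "stream_point L B w i = target L B s 3 t \<or> stream_point L B w i = target L B s 4 t"
      proof -
        have "3 + (i - 3 * L * B) mod 2 = 3 \<or> 3 + (i - 3 * L * B) mod 2 = 4"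
          by auto
        moreover have "(i - 3 * L * B) div 2 < L" if "\<not> i < 3 * L * B" "i < 3 * L * B + 2 * L"
          using that by linarith
        ultimately show ?thesis
          using that unfolding stream_point_def s_def[symmetric] by (smt (verit))
      qed
      then show ?thesis
      proof cases
        case 1
        then show ?thesis using remote by (auto simp: V_def)
      next
        case 2
        have j: "i div B < 3 * L"
          using 2(1) by (simp add: less_mult_imp_div_less)
        then have "i mod B \<noteq> s (i div B)"
          using off 2(2) by (auto simp: s_def hidden_def)
        then obtain t where "t \<le> L" "pierced ?r (upper_joint L B s t) (stream_point L B w i) \<or>
            pierced ?r (lower_joint L B s t) (stream_point L B w i)"
          using square_pierced[of s, OF s j, of "i mod B"] B 2(3) by auto
        then show ?thesis by (auto simp: V_def)
      next
        case (3 t)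
        then have "upper_joint L B s t \<in> V" "lower_joint L B s t \<in> V"
          by (auto simp: V_def)
        then show ?thesis
          using 3 cap_pierced[of s, OF s] by metis
      qed
    qed
    then show "\<exists>v\<in>V. P v b"
      using b stream_point_in_frame[OF B w] unfolding P_def by metis
  next
    fix v b b' assume "P v b" "P v b'"
    then obtain a a' where a: "b = place p (frame L B) ?r a" "in_frame (frame L B) a" "pierced ?r v a"
      "b' = place p (frame L B) ?r a'" "in_frame (frame L B) a'" "pierced ?r v a'"
      by (auto simp: P_def)
    then have "\<not> apart ?r a a'"
      by (intro pierced_imp_not_apart)
    then show "touching p b b'"
      using a touching_place_iff[OF p, of ?r "frame L B" a a'] radius_pos[of L B] by (auto simp: apart_def)
  qed
  also have "card V \<le> Suc (card (upper_joint L B s ` {..L} \<union> lower_joint L B s ` {..L}))"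
    unfolding V_def by (intro card_insert_le_m1) auto
  also have "card (upper_joint L B s ` {..L} \<union> lower_joint L B s ` {..L})
      \<le> card (upper_joint L B s ` {..L}) + card (lower_joint L B s ` {..L})"
    by (rule card_Un_le)
  also have "\<dots> \<le> card {..L} + card {..L}"
    by (intro add_mono card_image_le) auto
  finally show ?thesis by simp
qed

section \<open>Streaming algorithms as one-way protocols\<close>

lemma memory_prefix_cong:
  "(\<And>i. i < t \<Longrightarrow> bs ! i = bs' ! i) \<Longrightarrow> memory A bs t = memory A bs' t"
  by (induction t) auto

lemma memory_suffix_cong:
  assumes "T \<le> t" "memory A bs T = memory A bs' T" "\<And>i. T \<le> i \<Longrightarrow> i < t \<Longrightarrow> bs ! i = bs' ! i"
  shows "memory A bs t = memory A bs' t"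
  using assms by (induction t rule: dec_induct) auto

lemma ladder_square_cong:
  assumes "\<And>i. i < j \<Longrightarrow> s i = s' i"
  shows "ladder_square L B s j p = ladder_square L B s' j p"
proof -
  have "drift d L B s j = drift d L B s' j" for d
    unfolding drift_def using assms by (intro sum.cong) auto
  then show ?thesis
    by (simp add: ladder_square_def offset_def)
qed

text \<open>A player does not know its own hidden index, and its set does not influence what later players write.\<close>
lemma stream_point_prefix:
  assumes "0 < B" "i < Suc k * B" "k < 3 * L"
  shows "stream_point L B (w(k := (X, a))) i = stream_point L B (w(k := (X, a'))) i"
proof -
  have "i div B \<le> k"
    using assms by (simp add: less_mult_imp_div_less flip: less_Suc_eq_le)
  then have "hidden L (w(k := (X, a))) l = hidden L (w(k := (X, a'))) l" if "l < i div B" for l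
    using that by (simp add: hidden_def)
  then have "ladder_square L B (hidden L (w(k := (X, a)))) (i div B) q = ladder_square L B (hidden L (w(k := (X, a')))) (i div B) q" for q
    by (rule ladder_square_cong)
  moreover have "Suc k * B \<le> 3 * L * B"
    using assms by (intro mult_right_mono) auto
  ultimately show ?thesis
    using assms by (simp add: stream_point_def)
qed

lemma stream_point_suffix:
  assumes "0 < B" "Suc k * B \<le> i"
  shows "stream_point L B (w(k := (X, a))) i = stream_point L B (w(k := (X', a))) i"
proof -
  have "Suc k \<le> i div B"
    using div_le_mono[OF assms(2), of B] assms(1) by simp
  moreover have "hidden L (w(k := (X, a))) = hidden L (w(k := (X', a)))"
    by (auto simp: hidden_def)
  ultimately show ?thesis
    by (simp add: stream_point_def)
qed

text \<open>The memory after the block of player \<open>k\<close> is a message that depends on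
  \<open>X\<close> but not on \<open>a\<close>; together with \<open>a\<close> it determines the
  rest of the run.\<close>

lemma hard_stream_one_way:
  fixes A :: "2 stream_alg" and M n S :: nat and w :: "nat \<Rightarrow> nat set \<times> nat"
  assumes B: "0 < B" and k: "k < 3 * L" and n: "3 * L * B \<le> n"
    and w: "\<forall>j<3 * L. w j \<in> Pow {..<B} \<times> {..<B}"
    and space: "\<And>w. \<forall>j<3 * L. snd (w j) < B \<Longrightarrow> \<forall>t\<le>n. length (memory A (hard_stream p L B n w) t) \<le> S"
  shows "\<exists>m g. \<forall>X\<subseteq>{..<B}. m X \<in> {xs :: bool list. length xs \<le> S} \<and>
    (\<forall>a<B. f (result A (hard_stream p L B n (w(k := (X, a))))) = g (m X) a)"
proof -
  define T where "T = Suc k * B"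
  have "T \<le> 3 * L * B"
    unfolding T_def using k by (intro mult_right_mono) auto
  then have T: "T \<le> n" using n by simp
  \<comment> \<open>The index 0 is a placeholder; any other gives the same prefix.\<close>
  define m where "m X = memory A (hard_stream p L B n (w(k := (X, 0)))) T" for X
  define out where "out X a = f (result A (hard_stream p L B n (w(k := (X, a)))))" for X a
  have m: "memory A (hard_stream p L B n (w(k := (X, a)))) T = m X" for X a
    unfolding m_def using T B k stream_point_prefix[of B _ k L w X a 0]
    by (intro memory_prefix_cong) (simp add: nth_hard_stream T_def)
  have out: "out X a = out X' a" if "m X = m X'" for X X' a
  proof -
    have "memory A (hard_stream p L B n (w(k := (X, a)))) n = memory A (hard_stream p L B n (w(k := (X', a)))) n"
    proof (rule memory_suffix_cong[OF T])
      show "memory A (hard_stream p L B n (w(k := (X, a)))) T = memory A (hard_stream p L B n (w(k := (X', a)))) T"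
        by (simp only: m that)
      fix i assume "T \<le> i" "i < n"
      then show "hard_stream p L B n (w(k := (X, a))) ! i = hard_stream p L B n (w(k := (X', a))) ! i"
        using stream_point_suffix[OF B, of k i L w X a X'] by (simp only: nth_hard_stream T_def)
    qed
    then show ?thesis by (simp add: out_def result_def)
  qed
  \<comment> \<open>Any set with the message \<open>q\<close> may represent it, since the output
    depends on the set only through the message.\<close>
  define g where "g q a = out (SOME X. m X = q) a" for q a
  have "out X a = g (m X) a" for X a
    unfolding g_def using someI[of "\<lambda>Y. m Y = m X" X] by (intro out) simp
  moreover have "length (m X) \<le> S" if "X \<subseteq> {..<B}" for X
    unfolding m_def using w B T by (intro space[rule_format]) auto
  ultimately show ?thesis
    unfolding out_def by (intro exI[of _ m] exI[of _ g]) auto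
qed

lemma card_bool_lists_le:
  "finite {xs :: bool list. length xs \<le> S}" "ln (card {xs :: bool list. length xs \<le> S}) \<le> real S + 1"
proof -
  have eq: "{xs :: bool list. length xs \<le> S} = {xs. set xs \<subseteq> UNIV \<and> length xs \<le> S}"
    by simp
  show fin: "finite {xs :: bool list. length xs \<le> S}"
    unfolding eq by (intro finite_lists_length_le) simp
  have "card {xs :: bool list. length xs \<le> S} = (\<Sum>i\<le>S. 2 ^ i)"
    unfolding eq by (subst card_lists_length_le) auto
  also have "\<dots> \<le> 2 ^ Suc S"
    by (induction S) auto
  finally have "real (card {xs :: bool list. length xs \<le> S}) \<le> real (2 ^ Suc S)"
    by (simp only: of_nat_le_iff)
  moreover have "0 < card {xs :: bool list. length xs \<le> S}"
    using fin by (auto simp: card_gt_0_iff intro: exI[of _ "[]"])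
  ultimately have "ln (card {xs :: bool list. length xs \<le> S}) \<le> ln (2 ^ Suc S)"
    by simp
  also have "\<dots> = Suc S * ln 2"
    by (simp only: ln_realpow)
  also have "\<dots> \<le> real (Suc S) * 1"
    using ln_2_less_1 by (intro mult_left_mono) auto
  finally show "ln (card {xs :: bool list. length xs \<le> S}) \<le> real S + 1"
    by simp
qed

text \<open>Comparing the output with a threshold tells the two extreme hybrids apart with advantage
  \<open>2 * \<rho> - 1\<close>, which the chain bound limits in terms of the memory.\<close>

lemma chain_space_bound:
  fixes R :: "2 stream_alg pmf" and c \<rho> :: real
  assumes p: "p = 1 \<or> p = \<infinity>" and B: "0 < B" and L: "0 < L" and n: "3 * L * B + 2 * L < n"
    and M: "2 * frame L B \<le> int M"
    and c: "c * (2 * real L + 3) < 5 * real L + 1" and \<rho>: "1 / 2 < \<rho>"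
    and alg: "\<And>bs. ball_stream n M bs \<Longrightarrow> dilation bs = 1 \<Longrightarrow> uses_space R bs S \<and> approximates_alpha R p c \<rho> bs"
  shows "(2 * \<rho> - 1)\<^sup>2 * B \<le> 144 * (real L)\<^sup>2 * (real S + 1)"
proof -
  let ?H = "hard_stream p L B n" and ?W = "chain_inputs (3 * L) B"
  define J where "J = 3 * L"
  define \<gamma> where "\<gamma> = 2 * \<rho> - 1"
  \<comment> \<open>The independence number is at most \<open>\<theta>\<close> when all hidden
    members are absent; when all are present, the hypothesis on \<open>c\<close> puts every
    approximation above \<open>\<theta>\<close>.\<close>
  define \<theta> where "\<theta> = 2 * real L + 3"
  \<comment> \<open>With this choice the quadratic term on the right of the chain bound is half of
    the left side.\<close>
  define lam where "lam = \<gamma> / (4 * J)"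
  have stream: "uses_space R (?H w) S" "approximates_alpha R p c \<rho> (?H w)"
    if "\<forall>j<3 * L. snd (w j) < B" for w
    using alg[OF ball_stream_hard_stream[OF B that M] dilation_hard_stream] n by auto
  have valid: "\<forall>j<3 * L. snd (force k w j) < B" if "w \<in> ?W" for w k
    using that by (auto simp: chain_inputs_def force_def PiE_iff mem_Times_iff)
  have high: "\<rho> \<le> measure_pmf.prob R {A. \<theta> < result A (?H (force (3 * L) w))}" if w: "w \<in> ?W" for w
  proof -
    let ?a = "independence_number (intersection_graph p (?H (force (3 * L) w)))"
    have a: "5 * L + 1 \<le> ?a"
      using valid[OF w] n by (intro independence_number_hard_stream_ge[OF p B]) (auto simp: force_def)
    have "\<theta> < z" if "is_approximation c ?a z" for z
    proof -
      have "0 < c" using that by (simp add: is_approximation_def)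
      then have "\<theta> < (5 * real L + 1) / c"
        using c by (simp add: \<theta>_def field_simps)
      also have "\<dots> \<le> real ?a / c"
        using a \<open>0 < c\<close> by (intro divide_right_mono) auto
      also have "\<dots> \<le> z"
        using that by (simp add: is_approximation_def)
      finally show ?thesis .
    qed
    then have "{A. is_approximation c ?a (result A (?H (force (3 * L) w)))} \<subseteq> {A. \<theta> < result A (?H (force (3 * L) w))}"
      by auto
    then have "measure_pmf.prob R {A. is_approximation c ?a (result A (?H (force (3 * L) w)))}
        \<le> measure_pmf.prob R {A. \<theta> < result A (?H (force (3 * L) w))}"
      by (intro measure_pmf.finite_measure_mono) auto
    then show ?thesis
      using stream(2)[OF valid[OF w, of "3 * L"]] unfolding approximates_alpha_def by linarith
  qed
  have low: "measure_pmf.prob R {A. \<theta> < result A (?H (force 0 w))} \<le> 1 - \<rho>" if w: "w \<in> ?W" for w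
  proof -
    let ?a = "independence_number (intersection_graph p (?H (force 0 w)))"
    let ?E = "{A. is_approximation c ?a (result A (?H (force 0 w)))}"
    have "?a \<le> 2 * L + 3"
      using valid[OF w] by (intro independence_number_hard_stream_le[OF p B]) (auto simp: force_def)
    then have "{A. \<theta> < result A (?H (force 0 w))} \<subseteq> - ?E"
      by (auto simp: is_approximation_def \<theta>_def)
    then have "measure_pmf.prob R {A. \<theta> < result A (?H (force 0 w))} \<le> measure_pmf.prob R (- ?E)"
      by (intro measure_pmf.finite_measure_mono) auto
    also have "\<dots> = 1 - measure_pmf.prob R ?E"
      by (simp add: measure_pmf.prob_compl[of ?E R, simplified] Compl_eq_Diff_UNIV)
    also have "\<dots> \<le> 1 - \<rho>"
      using stream(2)[OF valid[OF w, of 0]] by (simp add: approximates_alpha_def)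
    finally show ?thesis .
  qed
  define f :: "2 stream_alg \<Rightarrow> real" where "f A = (\<Sum>w\<in>?W. indicator {A. \<theta> < result A (?H (force (3 * L) w))} A
      - indicator {A. \<theta> < result A (?H (force 0 w))} A)" for A
  have W: "?W \<noteq> {}"
    using B by (auto simp: chain_inputs_def PiE_eq_empty_iff)
  then have cardW: "0 < card ?W"
    by (simp add: card_gt_0_iff)
  have "\<rho> \<le> 1"
    using W high measure_pmf.prob_le_1 order_trans by blast
  then have \<gamma>: "0 < \<gamma>" "\<gamma> \<le> 1"
    using \<rho> by (auto simp: \<gamma>_def)
  have J: "1 \<le> J" using L by (simp add: J_def)
  have lam: "0 < lam" "lam \<le> 1"
    using \<gamma> J by (auto simp: lam_def divide_simps)
  have ind: "integrable R (indicator E :: _ \<Rightarrow> real)" for E :: "2 stream_alg set"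
    by (intro measure_pmf.integrable_const_bound[where B = 1]) (auto simp: indicator_def)
  have intf: "integrable R f"
    unfolding f_def by (intro Bochner_Integration.integrable_sum Bochner_Integration.integrable_diff ind)
  have "card ?W * \<gamma> = (\<Sum>w\<in>?W. \<rho> - (1 - \<rho>))"
    by (simp add: \<gamma>_def)
  also have "\<dots> \<le> (\<Sum>w\<in>?W. measure_pmf.prob R {A. \<theta> < result A (?H (force (3 * L) w))} - measure_pmf.prob R {A. \<theta> < result A (?H (force 0 w))})"
    using high low by (intro sum_mono diff_mono) auto
  also have "\<dots> = measure_pmf.expectation R f"
    unfolding f_def
    by (simp add: Bochner_Integration.integral_sum Bochner_Integration.integral_diff ind)
  finally have mean: "card ?W * \<gamma> \<le> measure_pmf.expectation R f" .
  \<comment> \<open>The bound holds for each deterministic algorithm in the support, hence for the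
    expectation over \<open>R\<close>.\<close>
  have "lam * B * f A \<le> 2 * J * card ?W * ((S + 1) + lam\<^sup>2 * B)" if A: "A \<in> set_pmf R" for A
  proof -
    define out :: "(nat \<Rightarrow> nat set \<times> nat) \<Rightarrow> real" where "out w = indicator {A. \<theta> < result A (?H w)} A" for w
    have "lam * B * (\<Sum>w\<in>?W. out (force (3 * L) w) - out (force 0 w))
        \<le> 2 * real (3 * L) * card ?W * (ln (card {xs :: bool list. length xs \<le> S}) + lam\<^sup>2 * B)"
    proof (rule chain_advantage_le[where out = out and J = "3 * L"])
      fix w :: "nat \<Rightarrow> nat set \<times> nat" and k
      assume w: "k < 3 * L" "\<forall>j<3 * L. w j \<in> Pow {..<B} \<times> {..<B}"
      have "\<forall>t\<le>n. length (memory A (?H w) t) \<le> S" if "\<forall>j<3 * L. snd (w j) < B" for w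
        using stream(1)[OF that] A by (simp add: uses_space_def)
      from hard_stream_one_way[OF B w(1) _ w(2) this, of "\<lambda>z. of_bool (\<theta> < z) :: real"] n
      show "\<exists>m g. \<forall>X\<subseteq>{..<B}. m X \<in> {xs :: bool list. length xs \<le> S} \<and> (\<forall>i<B. out (w(k := (X, i))) = g (m X) i)"
        by (simp add: out_def indicator_def)
    qed (use B lam card_bool_lists_le(1) in \<open>auto simp: out_def\<close>)
    also have "\<dots> \<le> 2 * real (3 * L) * card ?W * ((S + 1) + lam\<^sup>2 * B)"
      using card_bool_lists_le(2)[of S] by (intro mult_left_mono add_right_mono) auto
    finally show ?thesis
      by (simp add: f_def out_def J_def)
  qed
  then have "f A \<le> 2 * J * card ?W * ((S + 1) + lam\<^sup>2 * B) / (lam * B)" if "A \<in> set_pmf R" for A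
    using that lam B by (simp add: field_simps)
  then have "measure_pmf.expectation R f \<le> 2 * J * card ?W * ((S + 1) + lam\<^sup>2 * B) / (lam * B)"
    using intf by (intro measure_pmf.integral_le_const) (auto intro: AE_pmfI)
  with mean have "card ?W * \<gamma> \<le> 2 * J * card ?W * ((S + 1) + lam\<^sup>2 * B) / (lam * B)"
    by linarith
  then have "card ?W * (\<gamma> * (lam * B)) \<le> card ?W * (2 * J * ((S + 1) + lam\<^sup>2 * B))"
    using lam B by (simp add: field_simps)
  then have "\<gamma> * (lam * B) \<le> 2 * J * ((S + 1) + lam\<^sup>2 * B)"
    using cardW by (simp add: mult_le_cancel_left_pos)
  then have "real J * (\<gamma>\<^sup>2 * B) \<le> real J * (16 * (real J)\<^sup>2 * (S + 1))"
    using J by (simp add: lam_def field_simps power2_eq_square)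
  then have "\<gamma>\<^sup>2 * B \<le> 16 * (real J)\<^sup>2 * (S + 1)"
    using J by (simp add: mult_le_cancel_left_pos)
  then show ?thesis
    by (simp add: \<gamma>_def J_def power_mult_distrib add.commute)
qed

section \<open>Choice of parameters and the linear bound\<close>

theorem theorem13:
  fixes \<epsilon> \<rho> :: real and p :: ereal
  assumes "\<epsilon> > 0" and "\<rho> > 1 / 2" and "p = 1 \<or> p = \<infinity>"
  shows "\<exists>k. \<forall>(M :: nat \<Rightarrow> nat) (R :: nat \<Rightarrow> 2 stream_alg pmf) (s :: nat \<Rightarrow> nat).
    (\<forall>\<^sub>F n in sequentially. n ^ k \<le> M n) \<and>
    (\<exists>l. (\<lambda>n. real (M n)) \<in> O(\<lambda>n. real n ^ l)) \<and>
    (\<forall>n\<ge>1. \<forall>bs. ball_stream n (M n) bs \<and> dilation bs = 1 \<longrightarrow>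
       uses_space (R n) bs (s n) \<and> approximates_alpha (R n) p (5 / 2 - \<epsilon>) \<rho> bs)
    \<longrightarrow> (\<lambda>n. real (s n)) \<in> \<Omega>(\<lambda>n. real n)"
proof -
  \<comment> \<open>Then \<open>2 * \<epsilon> * L\<close> is at least 8, which makes (5 L + 1) / (2
    L + 3) larger than 5/2 - \<epsilon>.\<close>
  define L where "L = nat \<lceil>4 / \<epsilon>\<rceil>"
  have "4 / \<epsilon> \<le> real L"
    by (simp add: L_def real_nat_ceiling_ge)
  then have L\<epsilon>: "4 \<le> \<epsilon> * real L"
    using assms(1) by (simp add: field_simps)
  then have L: "0 < L"
    by (cases L) auto
  have c: "(5 / 2 - \<epsilon>) * (2 * real L + 3) < 5 * real L + 1"
    using L\<epsilon> assms(1) by (simp add: algebra_simps)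
  \<comment> \<open>864 = 6 * 144, from \<open>n \<le> 6 * L * B\<close> and
    \<open>chain_space_bound\<close>.\<close>
  define \<kappa> where "\<kappa> = (2 * \<rho> - 1)\<^sup>2 / (864 * real L ^ 3)"
  have \<kappa>: "0 < \<kappa>"
    using assms(2) L by (simp add: \<kappa>_def)
  have bound: "\<kappa> / 2 * real n \<le> real (s n)"
    if M: "n ^ (3 * L + 5) \<le> M n" and large: "16 * (L + 11) \<le> n" "2 / \<kappa> \<le> real n"
      and alg: "\<forall>n\<ge>1. \<forall>bs. ball_stream n (M n) bs \<and> dilation bs = 1 \<longrightarrow>
        uses_space (R n) bs (s n) \<and> approximates_alpha (R n) p (5 / 2 - \<epsilon>) \<rho> bs"
    for M :: "nat \<Rightarrow> nat" and R :: "nat \<Rightarrow> 2 stream_alg pmf" and s n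
  proof -
    \<comment> \<open>The largest block size that leaves room for the caps and one padding
      square.\<close>
    define B where "B = (n - 2 * L - 1) div (3 * L)"
    have le: "3 * L * B \<le> n - 2 * L - 1"
      by (simp add: B_def)
    have lt: "n - 2 * L - 1 < 3 * L * (B + 1)"
      unfolding B_def using L dividend_less_times_div[of "3 * L" "n - 2 * L - 1"] by simp
    have "3 * B \<le> 3 * L * B"
      using L by simp
    also have "\<dots> \<le> n"
      using le by simp
    finally have "3 * B \<le> n" .
    moreover have "176 \<le> n"
      using large(1) by simp
    ultimately have Bn: "2 * B + 2 \<le> n"
      by simp
    \<comment> \<open>Fewer than \<open>5 * L + 1\<close> positions lie outside the blocks, less
      than half of the stream.\<close>
    have n6: "n \<le> 6 * L * B"
    proof -
      have "n \<le> (n - 2 * L - 1) + 2 * L + 1"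
        by simp
      also have "\<dots> < 3 * L * (B + 1) + 2 * L + 1"
        using lt by simp
      also have "\<dots> = 3 * (L * B) + 5 * L + 1"
        by simp
      finally have "2 * n < 2 * (3 * (L * B) + 5 * L + 1)"
        by simp
      moreover have "16 * L + 176 \<le> n"
        using large(1) by simp
      ultimately have "n < 6 * (L * B)"
        by simp
      then show ?thesis by simp
    qed
    have nlt: "3 * L * B + 2 * L < n"
    proof -
      have "3 * L * B + 2 * L \<le> n - 2 * L - 1 + 2 * L"
        using le by simp
      also have "\<dots> < n"
        using large(1) by simp
      finally show ?thesis .
    qed
    have B: "0 < B"
      using n6 large(1) by (cases B) auto
    have "2 * frame L B = 16 * (int L + 11) * (2 * int B + 2) ^ (3 * L + 4)"
      by (simp add: frame_def radius_def)
    \<comment> \<open>One factor \<open>n\<close> absorbs \<open>16 * (L + 11)\<close> and the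
      others the powers of \<open>2 * B + 2\<close>, which explains the exponent
      \<open>3 * L + 5\<close>.\<close>
    also have "\<dots> \<le> int n * int n ^ (3 * L + 4)"
      using large(1) Bn by (intro mult_mono power_mono) auto
    also have "\<dots> = int (n ^ (3 * L + 5))"
      by (simp add: eval_nat_numeral)
    also have "\<dots> \<le> int (M n)"
      using M by (simp only: of_nat_le_iff)
    finally have fr: "2 * frame L B \<le> int (M n)" .
    have "real n \<le> real (6 * L * B)"
      using n6 by (simp only: of_nat_le_iff)
    then have "(2 * \<rho> - 1)\<^sup>2 * real n \<le> (2 * \<rho> - 1)\<^sup>2 * real (6 * L * B)"
      by (intro mult_left_mono) auto
    also have "\<dots> = 6 * real L * ((2 * \<rho> - 1)\<^sup>2 * B)"
      by simp
    also have "\<dots> \<le> 6 * real L * (144 * (real L)\<^sup>2 * (real (s n) + 1))"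
    proof (intro mult_left_mono)
      have alg_n: "uses_space (R n) bs (s n) \<and> approximates_alpha (R n) p (5 / 2 - \<epsilon>) \<rho> bs"
        if "ball_stream n (M n) bs" "dilation bs = 1" for bs
        using alg that nlt by fastforce
      show "(2 * \<rho> - 1)\<^sup>2 * B \<le> 144 * (real L)\<^sup>2 * (real (s n) + 1)"
        by (rule chain_space_bound[OF assms(3) B L nlt fr c assms(2) alg_n])
    qed simp
    finally have "(2 * \<rho> - 1)\<^sup>2 * real n \<le> 6 * real L * (144 * (real L)\<^sup>2 * (real (s n) + 1))" .
    then have "\<kappa> * real n \<le> real (s n) + 1"
      using L by (simp add: \<kappa>_def field_simps power2_eq_square power3_eq_cube)
    moreover have "1 \<le> \<kappa> / 2 * real n"
      using large(2) \<kappa> by (simp add: field_simps)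
    ultimately show ?thesis by simp
  qed
  show ?thesis
  proof (intro exI[of _ "3 * L + 5"] allI impI, elim conjE)
    fix M :: "nat \<Rightarrow> nat" and R :: "nat \<Rightarrow> 2 stream_alg pmf" and s :: "nat \<Rightarrow> nat"
    assume M: "\<forall>\<^sub>F n in sequentially. n ^ (3 * L + 5) \<le> M n"
      and alg: "\<forall>n\<ge>1. \<forall>bs. ball_stream n (M n) bs \<and> dilation bs = 1 \<longrightarrow>
        uses_space (R n) bs (s n) \<and> approximates_alpha (R n) p (5 / 2 - \<epsilon>) \<rho> bs"
    have "\<forall>\<^sub>F n in sequentially. \<kappa> / 2 * norm (real n) \<le> norm (real (s n))"
      using M eventually_ge_at_top[of "16 * (L + 11)"] eventually_ge_at_top[of "nat \<lceil>2 / \<kappa>\<rceil>"]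
    proof eventually_elim
      case (elim n)
      then have "2 / \<kappa> \<le> real n"
        by linarith
      with elim show ?case
        using bound[OF _ _ _ alg] by simp
    qed
    then show "(\<lambda>n. real (s n)) \<in> \<Omega>(\<lambda>n. real n)"
      using \<kappa> by (intro landau_omega.bigI[of "\<kappa> / 2"]) auto
  qed
qed

end
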